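(* Let $n\ge1$ and $a=(a_1,\dots,a_n)$ with integers $a_i\ge 2$, and let $a^\vee=(a_n,\dots,a_1)$. Then $\hat\Gamma_a^0$ is isomorphic to $\tilde L_{a^\vee}$ as an extension of $\Gamma_a^0\cong L^0_{a^\vee}$ by $\mathbb Z$ (the isomorphism sends $1\in\mathbb Z\subset\hat\Gamma^0_a$ to $T$). Under this isomorphism the element $\tau\in\tilde L_{a^\vee}$ corresponds to a graded lift $\tilde\phi_a$ of $\phi_a$.
   Context: **The group $\Gamma_a^0$.** $\Gamma_a^0=\{(\lambda_1,\dots,\lambda_n)\in(\mathbb C^* )^n:\ \lambda_1^{a_1}\lambda_2=\dots=\lambda_{n-1}^{a_{n-1}}\lambda_n=\lambda_n^{a_n}=1\}$, a cyclic group of order $d(a)=a_1\cdots a_n$; $\phi_a$ is its generator with $\lambda_1=e^{2\pi i/d(a)}$. $\Gamma^0_a$ acts on $\mathbb C^n$ (standard symplectic structure) by diagonal symplectomorphisms. **Graded symplectomorphisms.** Use $\Omega=dx_1\wedge\dots\wedge dx_n$. For a Lagrangian subspace $\Lambda$ of a tangent space, with basis $v_1,\dots,v_n$, let $\alpha(\Lambda)=\Omega(v_1,\dots,v_n)^2/|\Omega(v_1,\dots,v_n)|^2\in S^1$. A graded symplectomorphism is a symplectomorphism $\phi$ together with a continuous real function $g$ on the bundle of Lagrangian subspaces such that $e^{2\pi i g(\Lambda)}=\alpha(D\phi(\Lambda))/\alpha(\Lambda)$; composition is $(\phi,g)\circ(\phi',g')=(\phi\circ\phi',\,g\circ D\phi'+g')$.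 It is called a graded lift of $\phi$. The integer $k$ is identified with the graded lift of the identity with $g=-k$ (the shift $[k]$). $\hat\Gamma_a^0$ is the group of graded symplectomorphisms of $\mathbb C^n$ whose underlying symplectomorphism is the action of an element of $\Gamma_a^0$; it fits in $0\to\mathbb Z\to\hat\Gamma_a^0\to\Gamma_a^0\to0$. **The group $\tilde L_b$.** For $b=(b_1,\dots,b_n)$ let $L_b$ be the abelian group with generators $\bar x_1,\dots,\bar x_n,\bar p$ and relations $b_1\bar x_1+\bar x_2=\dots=b_{n-1}\bar x_{n-1}+\bar x_n=b_n\bar x_n=\bar p$. $\tilde L_b$ is obtained from $L_b$ by adding a generator $T$ with $2T=\bar p$. Put $\tau=(-1)^n\bar x_1$. Then $\tilde L_b$ is generated by $T,\tau$ with the single relation $d(b)\tau=(-1)^n2(d(b)-\mu(b))T$, where $\mu(b)=\sum_{j=0}^n(-1)^jb_{j+1}\cdots b_n$. Let $L_b^0=\mathrm{Hom}(\Gamma_b^0,\mathbb C^* )$; there is an exact sequence $0\to\mathbb Z\xrightarrow{T}\tilde L_b\to L_b^0\to0$, with $L_b^0$ cyclic of order $d(b)$ generated by the image of $\tau$. The groups $\Gamma_a^0$ and $L_{a^\vee}^0$ (both cyclic of order $d(a)$) are identified by matching $\phi_a$ with the image of $\tau$. *)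

theory Defs
  imports "HOL-Analysis.Analysis" "HOL-Algebra.Free_Abelian_Groups"
begin

section \<open>Symplectic geometry of \<open>\<complex>\<^sup>n\<close>\<close>

text \<open>
  \<open>\<complex>\<^sup>n\<close> is \<open>complex ^ 'n\<close> with \<open>n = CARD('n)\<close>; subspaces, spans, independence and dimensions
  are over the reals. Every tangent space is identified with \<open>\<complex>\<^sup>n\<close>.
\<close>

text \<open>
  Smoothness: all iterated directional derivatives exist and are Frechet differentiable
  everywhere. For finite-dimensional spaces this is \<open>C\<^sup>\<infinity>\<close>.
\<close>

coinductive smooth :: "('a::euclidean_space \<Rightarrow> 'b::euclidean_space) \<Rightarrow> bool" where
  "\<lbrakk>\<forall>x. f differentiable (at x); \<forall>v. smooth (\<lambda>x. frechet_derivative f (at x) v)\<rbrakk> \<Longrightarrow> smooth f"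

text \<open>The standard symplectic form \<open>\<Sum>\<^sub>j d(Re x\<^sub>j) \<and> d(Im x\<^sub>j)\<close>.\<close>

definition symp_form :: "complex ^ 'n \<Rightarrow> complex ^ 'n \<Rightarrow> real" where
  "symp_form v w = (\<Sum>j\<in>UNIV. Im (cnj (v $ j) * w $ j))"

definition symplectomorphism :: "(complex ^ 'n \<Rightarrow> complex ^ 'n) \<Rightarrow> bool" where
  "symplectomorphism \<phi> \<longleftrightarrow> bij \<phi> \<and> smooth \<phi> \<and> smooth (inv_into UNIV \<phi>) \<and>
     (\<forall>p v w. symp_form (frechet_derivative \<phi> (at p) v) (frechet_derivative \<phi> (at p) w) =
              symp_form v w)"

definition lagrangian :: "(complex ^ 'n) set \<Rightarrow> bool" where
  "lagrangian \<Lambda> \<longleftrightarrow> subspace \<Lambda> \<and> dim \<Lambda> = CARD('n) \<and> (\<forall>v\<in>\<Lambda>. \<forall>w\<in>\<Lambda>. symp_form v w = 0)"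

text \<open>A frame \<open>v\<close> lists the vectors \<open>v $ j\<close>, that is, the rows of a matrix.\<close>

definition is_basis :: "complex ^ 'n ^ 'n \<Rightarrow> (complex ^ 'n) set \<Rightarrow> bool" where
  "is_basis v \<Lambda> \<longleftrightarrow> inj (($) v) \<and> independent (range (($) v)) \<and> span (range (($) v)) = \<Lambda>"

definition lagrangian_frames :: "(complex ^ 'n ^ 'n) set" where
  "lagrangian_frames = {v. \<exists>\<Lambda>. lagrangian \<Lambda> \<and> is_basis v \<Lambda>}"

text \<open>
  The Lagrangian Grassmannian carries the quotient topology from the space of Lagrangian
  frames. As \<open>T\<complex>\<^sup>n\<close> is trivial, the bundle of Lagrangian subspaces is a product.
\<close>

definition lagrangian_grassmannian :: "(complex ^ 'n) set topology" where
  "lagrangian_grassmannian = topology (\<lambda>U. U \<subseteq> {\<Lambda>. lagrangian \<Lambda>} \<and>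
     openin (top_of_set lagrangian_frames) {v \<in> lagrangian_frames. span (range (($) v)) \<in> U})"

definition lagrangian_bundle :: "((complex ^ 'n) \<times> (complex ^ 'n) set) topology" where
  "lagrangian_bundle = prod_topology euclidean lagrangian_grassmannian"

lemma openin_lagrangian_grassmannian:
  "openin lagrangian_grassmannian U \<longleftrightarrow> U \<subseteq> {\<Lambda>. lagrangian \<Lambda>} \<and>
     openin (top_of_set lagrangian_frames) {v \<in> lagrangian_frames. span (range (($) v)) \<in> U}"
proof -
  let ?P = "\<lambda>U. {v \<in> lagrangian_frames. span (range (($) v)) \<in> U}"
  have "istopology (\<lambda>U. U \<subseteq> {\<Lambda>. lagrangian \<Lambda>} \<and> openin (top_of_set lagrangian_frames) (?P U))"
    unfolding istopology_def
  proof (intro conjI allI impI)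
    fix S T :: "(complex ^ 'n) set set"
    assume "S \<subseteq> {\<Lambda>. lagrangian \<Lambda>} \<and> openin (top_of_set lagrangian_frames) (?P S)"
      and "T \<subseteq> {\<Lambda>. lagrangian \<Lambda>} \<and> openin (top_of_set lagrangian_frames) (?P T)"
    moreover have "?P (S \<inter> T) = ?P S \<inter> ?P T"
      by auto
    ultimately show "S \<inter> T \<subseteq> {\<Lambda>. lagrangian \<Lambda>}" "openin (top_of_set lagrangian_frames) (?P (S \<inter> T))"
      by (auto intro: openin_Int)
  next
    fix K :: "(complex ^ 'n) set set set"
    assume K: "\<forall>S\<in>K. S \<subseteq> {\<Lambda>. lagrangian \<Lambda>} \<and> openin (top_of_set lagrangian_frames) (?P S)"
    have "?P (\<Union>K) = \<Union>(?P ` K)"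
      by auto
    moreover have "openin (top_of_set lagrangian_frames) (\<Union>(?P ` K))"
      by (rule openin_Union) (use K in blast)
    ultimately show "openin (top_of_set lagrangian_frames) (?P (\<Union>K))"
      by (rule ssubst)
    show "\<Union>K \<subseteq> {\<Lambda>. lagrangian \<Lambda>}"
      using K by blast
  qed
  then show ?thesis
    unfolding lagrangian_grassmannian_def by (rule topology_inverse' [THEN fun_cong])
qed

lemma topspace_lagrangian_grassmannian: "topspace lagrangian_grassmannian = {\<Lambda>. lagrangian \<Lambda>}"
proof
  show "topspace lagrangian_grassmannian \<subseteq> {\<Lambda>. lagrangian (\<Lambda> :: (complex ^ 'n) set)}"
    using openin_lagrangian_grassmannian openin_topspace by blast
  have eq: "{v \<in> lagrangian_frames. span (range (($) v)) \<in> {\<Lambda>. lagrangian \<Lambda>}} =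
        (lagrangian_frames :: (complex ^ 'n ^ 'n) set)"
    by (auto simp: lagrangian_frames_def is_basis_def)
  have "openin lagrangian_grassmannian {\<Lambda>. lagrangian (\<Lambda> :: (complex ^ 'n) set)}"
    unfolding openin_lagrangian_grassmannian eq by (simp only: subset_refl openin_subtopology_self simp_thms)
  then show "{\<Lambda>. lagrangian (\<Lambda> :: (complex ^ 'n) set)} \<subseteq> topspace lagrangian_grassmannian"
    by (rule openin_subset)
qed

lemma topspace_lagrangian_bundle: "topspace lagrangian_bundle = UNIV \<times> {\<Lambda>. lagrangian \<Lambda>}"
  by (simp add: lagrangian_bundle_def topspace_lagrangian_grassmannian)

text \<open>
  \<open>\<Omega>(v\<^sub>1, \<dots>, v\<^sub>n) = det v\<close> for \<open>\<Omega> = dx\<^sub>1 \<and> \<dots> \<and> dx\<^sub>n\<close>. The value below does not depend on the basis.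
\<close>

definition lag_phase :: "(complex ^ 'n) set \<Rightarrow> complex" where
  "lag_phase \<Lambda> = (THE z. \<exists>v. is_basis v \<Lambda> \<and> z = (det v)\<^sup>2 / (of_real (cmod (det v)))\<^sup>2)"

definition tangent_action ::
  "(complex ^ 'n \<Rightarrow> complex ^ 'n) \<Rightarrow> (complex ^ 'n) \<times> (complex ^ 'n) set \<Rightarrow>
   (complex ^ 'n) \<times> (complex ^ 'n) set" where
  "tangent_action \<phi> = (\<lambda>(p, \<Lambda>). (\<phi> p, frechet_derivative \<phi> (at p) ` \<Lambda>))"

text \<open>
  The grading function is taken extensional on the bundle of Lagrangian subspaces, so that it is
  determined by its values there.
\<close>

type_synonym 'n graded_map =
  "(complex ^ 'n \<Rightarrow> complex ^ 'n) \<times> ((complex ^ 'n) \<times> (complex ^ 'n) set \<Rightarrow> real)"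

definition graded_symplectomorphisms :: "('n::finite) graded_map monoid" where
  "graded_symplectomorphisms =
     \<lparr>carrier = {(\<phi>, g). symplectomorphism \<phi> \<and>
          g \<in> extensional (topspace lagrangian_bundle) \<and>
          continuous_map lagrangian_bundle euclideanreal g \<and>
          (\<forall>x \<in> topspace lagrangian_bundle.
             exp (2 * of_real pi * \<i> * of_real (g x)) =
               lag_phase (snd (tangent_action \<phi> x)) / lag_phase (snd x))},
      monoid.mult = (\<lambda>(\<phi>, g) (\<phi>', g').
          (\<phi> \<circ> \<phi>', \<lambda>x\<in>topspace lagrangian_bundle. g (tangent_action \<phi>' x) + g' x)),
      one = (id, \<lambda>x\<in>topspace lagrangian_bundle. 0)\<rparr>"

text \<open>The integer \<open>k\<close> acts as the shift \<open>[k]\<close>, the lift of the identity with \<open>g = - k\<close>.\<close>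

definition graded_shift :: "int \<Rightarrow> ('n::finite) graded_map" where
  "graded_shift k = (id, \<lambda>x\<in>topspace lagrangian_bundle. - of_int k)"


section \<open>The group \<open>\<Gamma>\<^sub>a\<^sup>0\<close> and its graded extension\<close>

text \<open>
  The tuple \<open>(a\<^sub>1, \<dots>, a\<^sub>n)\<close> is a list, so \<open>a\<^sub>i\<close> is \<open>a ! (i - 1)\<close> and the indices of \<open>\<lambda>\<close> are shifted
  likewise; the reversed tuple is \<open>rev a\<close>.
\<close>

definition cstar :: "complex monoid" where
  "cstar = \<lparr>carrier = - {0}, monoid.mult = (*), one = 1\<rparr>"

definition Gamma0 :: "nat list \<Rightarrow> (nat \<Rightarrow> complex) monoid" where
  "Gamma0 a = (product_group {..<length a} (\<lambda>_. cstar))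
     \<lparr>carrier := {l \<in> carrier (product_group {..<length a} (\<lambda>_. cstar)).
        (\<forall>i. Suc i < length a \<longrightarrow> l i ^ (a ! i) * l (Suc i) = 1) \<and>
        l (length a - 1) ^ (a ! (length a - 1)) = 1}\<rparr>"

definition Gamma0_gen :: "nat list \<Rightarrow> nat \<Rightarrow> complex" where
  "Gamma0_gen a = (THE l. l \<in> carrier (Gamma0 a) \<and> generate (Gamma0 a) {l} = carrier (Gamma0 a) \<and>
     l 0 = exp (2 * of_real pi * \<i> / of_nat (prod_list a)))"

text \<open>\<open>idx\<close> labels the coordinates of \<open>complex ^ 'n\<close> by \<open>0, \<dots>, n - 1\<close>.\<close>

definition diag_action :: "('n \<Rightarrow> nat) \<Rightarrow> (nat \<Rightarrow> complex) \<Rightarrow> complex ^ 'n \<Rightarrow> complex ^ 'n" where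
  "diag_action idx l z = (\<chi> j. l (idx j) * z $ j)"

definition Gamma0_hat :: "('n::finite \<Rightarrow> nat) \<Rightarrow> nat list \<Rightarrow> 'n graded_map monoid" where
  "Gamma0_hat idx a = graded_symplectomorphisms
     \<lparr>carrier := {x \<in> carrier graded_symplectomorphisms.
        fst x \<in> diag_action idx ` carrier (Gamma0 a)}\<rparr>"

definition Gamma0_hat_proj :: "('n::finite \<Rightarrow> nat) \<Rightarrow> nat list \<Rightarrow> 'n graded_map \<Rightarrow> nat \<Rightarrow> complex" where
  "Gamma0_hat_proj idx a x = inv_into (carrier (Gamma0 a)) (diag_action idx) (fst x)"


section \<open>The group \<open>L\<^sub>b\<close> with \<open>T\<close> adjoined, \<open>2T = p\<close>\<close>

datatype L_generator = Xgen nat | Pgen | Tgen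

definition L_relators :: "nat list \<Rightarrow> (L_generator \<Rightarrow>\<^sub>0 int) set" where
  "L_relators b =
     {frag_cmul (int (b ! i)) (frag_of (Xgen i)) + frag_of (Xgen (Suc i)) - frag_of Pgen |
        i. Suc i < length b} \<union>
     {frag_cmul (int (b ! (length b - 1))) (frag_of (Xgen (length b - 1))) - frag_of Pgen}"

definition Ltilde_free :: "nat list \<Rightarrow> (L_generator \<Rightarrow>\<^sub>0 int) monoid" where
  "Ltilde_free b = free_Abelian_group (Xgen ` {..<length b} \<union> {Pgen, Tgen})"

definition Ltilde_relations :: "nat list \<Rightarrow> (L_generator \<Rightarrow>\<^sub>0 int) set" where
  "Ltilde_relations b = generate (Ltilde_free b)
     (L_relators b \<union> {frag_cmul 2 (frag_of Tgen) - frag_of Pgen})"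

definition Ltilde :: "nat list \<Rightarrow> (L_generator \<Rightarrow>\<^sub>0 int) set monoid" where
  "Ltilde b = Ltilde_free b Mod Ltilde_relations b"

definition Ltilde_class :: "nat list \<Rightarrow> (L_generator \<Rightarrow>\<^sub>0 int) \<Rightarrow> (L_generator \<Rightarrow>\<^sub>0 int) set" where
  "Ltilde_class b c = Ltilde_relations b #>\<^bsub>Ltilde_free b\<^esub> c"

definition Ltilde_T :: "nat list \<Rightarrow> (L_generator \<Rightarrow>\<^sub>0 int) set" where
  "Ltilde_T b = Ltilde_class b (frag_of Tgen)"

definition Ltilde_tau :: "nat list \<Rightarrow> (L_generator \<Rightarrow>\<^sub>0 int) set" where
  "Ltilde_tau b = Ltilde_class b (frag_cmul ((- 1) ^ length b) (frag_of (Xgen 0)))"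

definition T_power :: "nat list \<Rightarrow> int \<Rightarrow> (L_generator \<Rightarrow>\<^sub>0 int) set" where
  "T_power b k = Ltilde_T b [^]\<^bsub>Ltilde b\<^esub> k"

definition L0 :: "nat list \<Rightarrow> ((nat \<Rightarrow> complex) \<Rightarrow> complex) monoid" where
  "L0 b =
     \<lparr>carrier = hom (Gamma0 b) cstar \<inter> extensional (carrier (Gamma0 b)),
      monoid.mult = (\<lambda>c d. \<lambda>l\<in>carrier (Gamma0 b). c l * d l),
      one = (\<lambda>l\<in>carrier (Gamma0 b). 1)\<rparr>"

text \<open>
  The projection to \<open>L\<^sub>b\<^sup>0\<close> sends \<open>Xgen i\<close> to the character \<open>l \<mapsto> l i\<close>, and \<open>Pgen\<close> and \<open>Tgen\<close> to the trivial
  one, so its kernel is generated by \<open>T\<close>. All representatives of a coset give the same character.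
\<close>

definition L_character :: "nat list \<Rightarrow> (L_generator \<Rightarrow>\<^sub>0 int) \<Rightarrow> (nat \<Rightarrow> complex) \<Rightarrow> complex" where
  "L_character b c =
     (\<lambda>l\<in>carrier (Gamma0 b). \<Prod>i<length b. l i powi Poly_Mapping.lookup c (Xgen i))"

definition Ltilde_proj ::
  "nat list \<Rightarrow> (L_generator \<Rightarrow>\<^sub>0 int) set \<Rightarrow> (nat \<Rightarrow> complex) \<Rightarrow> complex" where
  "Ltilde_proj b C = the_elem (L_character b ` C)"


section \<open>Extensions of groups\<close>

text \<open>
  \<open>1 \<rightarrow> N \<rightarrow> E \<rightarrow> Q \<rightarrow> 1\<close> is exact. (The library's short exact sequences require all three groups
  to have the same type.)
\<close>

definition group_extension ::
  "'a monoid \<Rightarrow> 'b monoid \<Rightarrow> 'c monoid \<Rightarrow> ('a \<Rightarrow> 'b) \<Rightarrow> ('b \<Rightarrow> 'c) \<Rightarrow> bool" where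
  "group_extension N E Q i p \<longleftrightarrow> group N \<and> group E \<and> group Q \<and>
     i \<in> mon N E \<and> p \<in> epi E Q \<and> i ` carrier N = kernel E Q p"

text \<open>\<open>\<Psi>\<close> is the identity on the kernel \<open>N\<close> and covers the identification \<open>\<theta>\<close> of the quotients.\<close>

definition extension_iso ::
  "'a monoid \<Rightarrow> 'b monoid \<Rightarrow> 'c monoid \<Rightarrow> ('a \<Rightarrow> 'b) \<Rightarrow> ('b \<Rightarrow> 'c) \<Rightarrow>
   'd monoid \<Rightarrow> 'e monoid \<Rightarrow> ('a \<Rightarrow> 'd) \<Rightarrow> ('d \<Rightarrow> 'e) \<Rightarrow> ('c \<Rightarrow> 'e) \<Rightarrow> ('b \<Rightarrow> 'd) \<Rightarrow> bool" where
  "extension_iso N E Q i p E' Q' i' p' \<theta> \<Psi> \<longleftrightarrow>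
     group_extension N E Q i p \<and> group_extension N E' Q' i' p' \<and>
     \<theta> \<in> iso Q Q' \<and> \<Psi> \<in> iso E E' \<and>
     (\<forall>k\<in>carrier N. \<Psi> (i k) = i' k) \<and> (\<forall>x\<in>carrier E. p' (\<Psi> x) = \<theta> (p x))"

end

theory Submission
  imports Defs
begin

text \<open>
  Both extensions are quotients of \<open>\<int>\<^sup>2\<close> by the same relation. A graded lift of a diagonal map of
  \<open>\<Gamma>\<^sub>a\<^sup>0\<close> has a constant grading function, because the bundle of Lagrangian subspaces is connected
  and the phase changes by the constant \<open>(\<Prod> \<lambda>\<^sub>j)\<^sup>2\<close>. As \<open>\<lambda>\<^sub>j = \<lambda>\<^sub>1\<close> to the power
  \<open>(-1)\<^sup>j\<^sup>-\<^sup>1 a\<^sub>1 \<cdots> a\<^sub>j\<^sub>-\<^sub>1\<close>, writing \<open>S\<close> for the sum of these exponents, the lifts are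
  \<open>(m, k) \<mapsto> (\<phi>\<^sub>a\<^sup>m, 2mS/d - k)\<close> with kernel generated by \<open>(d, 2S)\<close>. Eliminating the generators
  \<open>x\<^sub>2, \<dots>, x\<^sub>n\<close> and \<open>p\<close> leaves \<open>T\<close> and \<open>\<tau>\<close> with the relation \<open>d\<tau> + 2ST = 0\<close>, so that
  \<open>(m, k) \<mapsto> m\<tau> + kT\<close> has the same kernel.
\<close>

section \<open>Extensions with a two-generator presentation\<close>

text \<open>Only the pair (d, 2S) matters, and the reversal of \<open>a\<close> is what makes both
  sides give the same S. The elimination x_{i+1} = 2T - b_i x_i collects the T-coefficients by
  Horner's scheme, so it ends in an alternating sum of products of trailing entries of b. For b =
  \<open>rev a\<close> these are the products of leading entries of \<open>a\<close> that occur as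
  exponents of \<lambda>_1. The factor 2 has two origins: the square in the phase, and 2T = p.
  Elimination really leaves (-1)^n d x_1 + 2S T = 0, and the sign in \<tau> = (-1)^n x_1 absorbs the
  one in front of d. The relation with \<mu> is the same one, since \<mu>(\<open>rev a\<close>) = d
  + (-1)^n S. Surjections from Z and Z^2 also supply group axioms: \<open>Gamma0\<close>,
  \<open>L0\<close> and \<open>Gamma0_hat\<close> inherit them as homomorphic images, so no inverse
  of a graded map is ever constructed.\<close>

lemma group_epi_image:
  assumes "group G" "h \<in> epi G H" "h \<one>\<^bsub>G\<^esub> = \<one>\<^bsub>H\<^esub>"
  shows "group H"
proof -
  have "group (H \<lparr>carrier := h ` carrier G, one := h \<one>\<^bsub>G\<^esub>\<rparr>)"
    by (rule group.hom_imp_img_group) (use assms in \<open>auto simp: epi_def\<close>)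
  also have "H \<lparr>carrier := h ` carrier G, one := h \<one>\<^bsub>G\<^esub>\<rparr> = H"
    using assms by (simp add: epi_def)
  finally show ?thesis .
qed

lemma hom_eq_iff_diff_in_kernel:
  assumes "group A" "group B" "f \<in> hom A B" "x \<in> carrier A" "y \<in> carrier A"
  shows "f x = f y \<longleftrightarrow> x \<otimes>\<^bsub>A\<^esub> inv\<^bsub>A\<^esub> y \<in> kernel A B f"
proof -
  interpret group_hom A B f
    using assms by (simp add: group_hom_def group_hom_axioms_def)
  have "f (x \<otimes>\<^bsub>A\<^esub> inv\<^bsub>A\<^esub> y) = f x \<otimes>\<^bsub>B\<^esub> inv\<^bsub>B\<^esub> (f y)"
    using assms by simp
  then show ?thesis
    using assms by (auto simp: kernel_def H.inv_solve_right' H.inv_equality)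
qed

text \<open>Both targets are \<open>A\<close> modulo the common kernel. The map applies
  \<open>g\<close> to a chosen preimage under \<open>f\<close>; one inclusion of kernels makes the
  choice irrelevant, the other makes the map injective.\<close>

lemma iso_of_epis:
  assumes "group A" "group B" "group C" and f: "f \<in> epi A B" and g: "g \<in> epi A C"
    and ker: "kernel A B f = kernel A C g"
  shows "\<exists>h \<in> iso B C. \<forall>x \<in> carrier A. h (f x) = g x"
proof -
  have fh: "f \<in> hom A B" "f ` carrier A = carrier B" and gh: "g \<in> hom A C" "g ` carrier A = carrier C"
    using f g by (auto simp: epi_def)
  have eq: "f x = f y \<longleftrightarrow> g x = g y" if "x \<in> carrier A" "y \<in> carrier A" for x y
    using hom_eq_iff_diff_in_kernel[OF assms(1,2) fh(1) that]
      hom_eq_iff_diff_in_kernel[OF assms(1,3) gh(1) that] ker by simp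
  define h where "h y = g (inv_into (carrier A) f y)" for y
  have hf: "h (f x) = g x" if x: "x \<in> carrier A" for x
  proof -
    have "inv_into (carrier A) f (f x) \<in> carrier A" "f (inv_into (carrier A) f (f x)) = f x"
      using x by (auto intro: inv_into_into f_inv_into_f)
    then show ?thesis
      unfolding h_def using eq x by blast
  qed
  have "h \<in> hom B C"
  proof (rule homI)
    fix y z assume "y \<in> carrier B" "z \<in> carrier B"
    then obtain x w where "x \<in> carrier A" "y = f x" "w \<in> carrier A" "z = f w"
      using fh by blast
    moreover from this have "f x \<otimes>\<^bsub>B\<^esub> f w = f (x \<otimes>\<^bsub>A\<^esub> w)" "g x \<otimes>\<^bsub>C\<^esub> g w = g (x \<otimes>\<^bsub>A\<^esub> w)"
      using fh gh by (auto simp: hom_mult)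
    ultimately show "h y \<in> carrier C" "h (y \<otimes>\<^bsub>B\<^esub> z) = h y \<otimes>\<^bsub>C\<^esub> h z"
      using hf gh assms(1) by (auto simp: group.is_monoid monoid.m_closed)
  qed
  moreover have "bij_betw h (carrier B) (carrier C)"
    unfolding bij_betw_def
  proof
    show "inj_on h (carrier B)"
      using eq hf fh(2) by (auto simp: inj_on_def simp flip: fh(2))
    show "h ` carrier B = carrier C"
      using hf by (auto simp: image_iff simp flip: fh(2) gh(2))
  qed
  ultimately show ?thesis
    using hf by (auto simp: iso_def)
qed

text \<open>The extension Z -> Z^2 / Z(d, s) -> Z / dZ in coordinates. The surjections
  \<open>f\<close> and \<open>q\<close> are explicit parameters, so that an isomorphism can later be
  evaluated on named elements.\<close>

definition presented_extension ::
  "int \<Rightarrow> int \<Rightarrow> ('b, 'x) monoid_scheme \<Rightarrow> ('c, 'y) monoid_scheme \<Rightarrow> (int \<Rightarrow> 'b) \<Rightarrow> ('b \<Rightarrow> 'c) \<Rightarrow>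
   (int \<times> int \<Rightarrow> 'b) \<Rightarrow> (int \<Rightarrow> 'c) \<Rightarrow> bool" where
  "presented_extension d s E Q i p f q \<longleftrightarrow>
     group E \<and> group Q \<and> f \<in> epi (integer_group \<times>\<times> integer_group) E \<and> q \<in> epi integer_group Q \<and>
     (\<forall>m k. f (m, k) = \<one>\<^bsub>E\<^esub> \<longleftrightarrow> (\<exists>r. m = d * r \<and> k = s * r)) \<and>
     (\<forall>m. q m = \<one>\<^bsub>Q\<^esub> \<longleftrightarrow> d dvd m) \<and>
     (\<forall>m k. p (f (m, k)) = q m) \<and> (\<forall>k. i k = f (0, k))"

lemma presented_extension_group_extension:
  assumes "presented_extension d s E Q i p f q" and d: "d \<noteq> 0"
  shows "group_extension integer_group E Q i p"
proof -
  let ?ZZ = "integer_group \<times>\<times> integer_group"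
  have E: "group E" and Q: "group Q" and f: "f \<in> epi ?ZZ E" and q: "q \<in> epi integer_group Q"
    and f1: "\<And>m k. f (m, k) = \<one>\<^bsub>E\<^esub> \<longleftrightarrow> (\<exists>r. m = d * r \<and> k = s * r)"
    and q1: "\<And>m. q m = \<one>\<^bsub>Q\<^esub> \<longleftrightarrow> d dvd m"
    and p: "\<And>m k. p (f (m, k)) = q m" and i: "\<And>k. i k = f (0, k)"
    using assms(1) by (auto simp: presented_extension_def)
  have fadd: "f (m, k) \<otimes>\<^bsub>E\<^esub> f (m', k') = f (m + m', k + k')" for m k m' k'
    using f by (auto simp: epi_def hom_def)
  have qadd: "q m \<otimes>\<^bsub>Q\<^esub> q m' = q (m + m')" for m m'
    using q by (auto simp: epi_def hom_def)
  have fsurj: "carrier E = {f (m, k) |m k. True}"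
    using f by (force simp: epi_def)
  have qsurj: "carrier Q = range q"
    using q by (auto simp: epi_def)
  have i_hom: "i \<in> hom integer_group E"
    by (rule homI) (auto simp: i fadd fsurj)
  have p_hom: "p \<in> hom E Q"
    by (rule homI) (auto simp: p fadd qadd fsurj qsurj)
  have "inj_on i (carrier integer_group)"
  proof -
    \<comment> \<open>A relation (0, k) = r (d, s) forces r = 0, because d is nonzero.\<close>
    have "kernel integer_group E i = {\<one>\<^bsub>integer_group\<^esub>}"
      using d by (auto simp: kernel_def i f1)
    then show ?thesis
      using group_hom.inj_iff_trivial_ker[of integer_group E i] i_hom E
      by (simp add: group_hom_def group_hom_axioms_def)
  qed
  moreover have "p ` carrier E = carrier Q"
    by (force simp: fsurj qsurj p image_iff)
  moreover have "i ` carrier integer_group = kernel E Q p"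
  proof
    show "i ` carrier integer_group \<subseteq> kernel E Q p"
      by (auto simp: kernel_def i p q1 fsurj)
    show "kernel E Q p \<subseteq> i ` carrier integer_group"
    proof
      fix x assume "x \<in> kernel E Q p"
      then obtain m k where x: "x = f (m, k)" and "q m = \<one>\<^bsub>Q\<^esub>"
        by (auto simp: kernel_def fsurj p)
      then obtain r where m: "m = d * r"
        using q1 by auto
      have "f (d * r, s * r) = \<one>\<^bsub>E\<^esub>"
        using f1 by blast
      \<comment> \<open>Subtracting r times the relation (d, s) clears the first coordinate.\<close>
      moreover have "x = f (0, k - s * r) \<otimes>\<^bsub>E\<^esub> f (d * r, s * r)"
        by (simp add: fadd x m)
      moreover have "f (0, k - s * r) \<in> carrier E"
        by (auto simp: fsurj)
      ultimately have "x = i (k - s * r)"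
        using E by (simp add: i group.is_monoid monoid.r_one)
      then show "x \<in> i ` carrier integer_group"
        by simp
    qed
  qed
  ultimately show ?thesis
    using E Q i_hom p_hom by (simp add: group_extension_def mon_def epi_def)
qed

text \<open>Equal kernels give an isomorphism on each level by \<open>iso_of_epis\<close>. The two
  are compatible because every element of \<open>E\<close> is a value of \<open>f\<close>, where
  both projections are known.\<close>

lemma presented_extension_iso:
  assumes E: "presented_extension d s E Q i p f q" and E': "presented_extension d s E' Q' i' p' f' q'"
    and d: "d \<noteq> 0"
  shows "\<exists>\<theta> \<Psi>. extension_iso integer_group E Q i p E' Q' i' p' \<theta> \<Psi> \<and>
    (\<forall>m. \<theta> (q m) = q' m) \<and> (\<forall>m k. \<Psi> (f (m, k)) = f' (m, k))"
proof -
  let ?ZZ = "integer_group \<times>\<times> integer_group"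
  note E_def = E[unfolded presented_extension_def] and E'_def = E'[unfolded presented_extension_def]
  have "kernel integer_group Q q = kernel integer_group Q' q'"
    using E_def E'_def by (auto simp: kernel_def)
  then obtain \<theta> where \<theta>: "\<theta> \<in> iso Q Q'" "\<And>m. \<theta> (q m) = q' m"
    using iso_of_epis[of integer_group Q Q' q q'] E_def E'_def by auto
  have "group ?ZZ"
    by (simp add: DirProd_group)
  moreover have "kernel ?ZZ E f = kernel ?ZZ E' f'"
    using E_def E'_def by (auto simp: kernel_def)
  ultimately obtain \<Psi> where \<Psi>: "\<Psi> \<in> iso E E'" "\<And>m k. \<Psi> (f (m, k)) = f' (m, k)"
    using iso_of_epis[of ?ZZ E E' f f'] E_def E'_def by auto
  have "p' (\<Psi> x) = \<theta> (p x)" if "x \<in> carrier E" for x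
  proof -
    have "x \<in> range f"
      using that E_def by (auto simp: epi_def)
    then obtain m k where "x = f (m, k)"
      by auto
    then show ?thesis
      using E_def E'_def \<theta> \<Psi> by simp
  qed
  moreover have "\<Psi> (i k) = i' k" for k
    using E_def E'_def \<Psi> by simp
  ultimately have "extension_iso integer_group E Q i p E' Q' i' p' \<theta> \<Psi>"
    using \<theta>(1) \<Psi>(1) presented_extension_group_extension[OF E d]
      presented_extension_group_extension[OF E' d]
    by (simp add: extension_iso_def)
  then show ?thesis
    using \<theta>(2) \<Psi>(2) by blast
qed

section \<open>The groups of diagonal matrices and their characters\<close>

definition root_of_unity :: "int \<Rightarrow> int \<Rightarrow> complex" where
  "root_of_unity d k = cis (2 * pi * of_int k / of_int d)"

lemma root_of_unity_add: "root_of_unity d (k + l) = root_of_unity d k * root_of_unity d l"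
  by (simp add: root_of_unity_def cis_mult ring_distribs add_divide_distrib)

lemma root_of_unity_0 [simp]: "root_of_unity d 0 = 1"
  by (simp add: root_of_unity_def)

lemma root_of_unity_nonzero [simp]: "root_of_unity d k \<noteq> 0"
  by (simp add: root_of_unity_def)

lemma norm_root_of_unity [simp]: "cmod (root_of_unity d k) = 1"
  by (simp add: root_of_unity_def)

lemma root_of_unity_minus: "root_of_unity d (- k) = inverse (root_of_unity d k)"
  by (simp add: root_of_unity_def cis_inverse)

lemma root_of_unity_power: "root_of_unity d k ^ n = root_of_unity d (int n * k)"
  by (induction n) (simp_all add: root_of_unity_add ring_distribs)

lemma root_of_unity_power_int: "root_of_unity d k powi l = root_of_unity d (l * k)"
proof (cases "l \<ge> 0")
  case True
  then show ?thesis
    by (simp add: power_int_def root_of_unity_power)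
next
  case False
  then have "root_of_unity d (l * k) = root_of_unity d (- (int (nat (- l)) * k))"
    by simp
  then show ?thesis
    using False by (simp only: root_of_unity_minus root_of_unity_power power_int_def if_False power_inverse)
qed

lemma root_of_unity_prod:
  "(\<Prod>i\<in>A. root_of_unity d (k i)) = root_of_unity d (\<Sum>i\<in>A. k i)"
  by (induction A rule: infinite_finite_induct) (auto simp: root_of_unity_add)

lemma root_of_unity_eq_1_iff:
  assumes "d \<noteq> 0"
  shows "root_of_unity d k = 1 \<longleftrightarrow> d dvd k"
proof -
  have "root_of_unity d k = 1 \<longleftrightarrow> (\<exists>x::int. 2 * pi * of_int k / of_int d = 2 * pi * of_int x)"
    by (simp add: root_of_unity_def cis_conv_exp exp_eq_1 mult_ac)
  also have "\<dots> \<longleftrightarrow> (\<exists>x::int. real_of_int k = of_int (d * x))"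
    using assms by (simp add: field_simps)
  finally show ?thesis
    by (simp only: of_int_eq_iff dvd_def)
qed

lemma root_of_unity_surj:
  assumes "d > 0" "z ^ nat d = 1"
  shows "\<exists>k. z = root_of_unity d k"
proof -
  have "(\<lambda>k. cis (2 * pi * real k / real (nat d))) ` {..<nat d} = {z. z ^ nat d = 1}"
    using Complex.bij_betw_roots_unity[of "nat d"] assms(1) unfolding bij_betw_def by simp
  then have "z \<in> (\<lambda>k. cis (2 * pi * real k / real (nat d))) ` {..<nat d}"
    using assms(2) by blast
  then obtain k where "z = cis (2 * pi * real k / real (nat d))"
    by blast
  then show ?thesis
    using assms by (intro exI[of _ "int k"]) (simp add: root_of_unity_def)
qed

text \<open>The relations of \<open>Gamma0 a\<close> say \<open>\<lambda>\<^sub>i = \<lambda>\<^sub>0 ^ weight a i\<close>, those of \<open>L\<^sub>b\<close> say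
  \<open>x\<^sub>i = weight b i \<cdot> x\<^sub>0\<close> up to a multiple of \<open>T\<close>.\<close>

definition weight :: "nat list \<Rightarrow> nat \<Rightarrow> int" where
  "weight a i = (\<Prod>j<i. - int (a ! j))"

lemma weight_0 [simp]: "weight a 0 = 1"
  by (simp add: weight_def)

lemma weight_Suc [simp]: "weight a (Suc i) = - int (a ! i) * weight a i"
  by (simp add: weight_def)

lemma weight_Cons_Suc: "weight (x # a) (Suc i) = - int x * weight a i"
  unfolding weight_def by (subst prod.lessThan_Suc_shift) simp

lemma weight_length: "weight a (length a) = (- 1) ^ length a * int (prod_list a)"
  by (induction a) (simp_all add: weight_Cons_Suc del: weight_Suc)

section \<open>The diagonal group as the cyclic group of order d\<close>

lemma carrier_Gamma0:
  "l \<in> carrier (Gamma0 a) \<longleftrightarrow> l \<in> extensional {..<length a} \<and> (\<forall>i<length a. l i \<noteq> 0) \<and>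
     (\<forall>i. Suc i < length a \<longrightarrow> l i ^ (a ! i) * l (Suc i) = 1) \<and>
     l (length a - 1) ^ (a ! (length a - 1)) = 1"
  by (auto simp: Gamma0_def product_group_def cstar_def PiE_def Pi_def)

lemma mult_Gamma0: "l \<otimes>\<^bsub>Gamma0 a\<^esub> l' = (\<lambda>i\<in>{..<length a}. l i * l' i)"
  by (simp add: Gamma0_def product_group_def cstar_def)

lemma one_Gamma0: "\<one>\<^bsub>Gamma0 a\<^esub> = (\<lambda>i\<in>{..<length a}. 1)"
  by (simp add: Gamma0_def product_group_def cstar_def)

text \<open>The m-th power of \<phi>_a in closed form: coordinate 0 is exp(2 pi i m / d), and the
  defining relations dictate the rest.\<close>

definition Gamma0_power :: "nat list \<Rightarrow> int \<Rightarrow> nat \<Rightarrow> complex" where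
  "Gamma0_power a m = (\<lambda>i\<in>{..<length a}. root_of_unity (int (prod_list a)) (m * weight a i))"

text \<open>Each relation between neighbours solves for the next coordinate and multiplies the
  exponent by \<open>- a ! i\<close>; hence coordinate 0 determines the whole element.\<close>

lemma Gamma0_coordinate:
  assumes "l \<in> carrier (Gamma0 a)" "i < length a"
  shows "l i = l 0 powi weight a i"
  using assms(2)
proof (induction i)
  case 0
  then show ?case by simp
next
  case (Suc i)
  have "0 < length a"
    using Suc.prems by linarith
  then have "l 0 \<noteq> 0"
    using assms(1) carrier_Gamma0 by blast
  have "l i ^ (a ! i) * l (Suc i) = 1"
    using assms(1) Suc.prems by (auto simp: carrier_Gamma0)
  then have "l (Suc i) = inverse (l i ^ (a ! i))"
    by (metis inverse_unique)
  also have "\<dots> = l 0 powi weight a (Suc i)"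
    using Suc \<open>l 0 \<noteq> 0\<close> by (simp add: power_int_minus power_int_mult mult.commute)
  finally show ?case .
qed

context
  fixes a :: "nat list"
  assumes a: "a \<noteq> []" and pos: "prod_list a > 0"
begin

lemma Gamma0_power_in_carrier: "Gamma0_power a m \<in> carrier (Gamma0 a)"
proof -
  let ?n = "length a" and ?z = "root_of_unity (int (prod_list a))"
  have step: "?z (m * weight a i) ^ (a ! i) * ?z (m * weight a (Suc i)) = 1" for i
    by (simp add: root_of_unity_power flip: root_of_unity_add)
  \<comment> \<open>The last relation is a neighbour relation with a fictitious coordinate number
    \<open>?n\<close>. Its value is 1, because the weight there is d up to sign.\<close>
  have "?z (m * weight a ?n) = 1"
    using pos by (subst root_of_unity_eq_1_iff) (auto simp: weight_length)
  moreover have "Suc (?n - 1) = ?n"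
    using a by simp
  ultimately have "?z (m * weight a (?n - 1)) ^ (a ! (?n - 1)) = 1"
    using step[of "?n - 1"] by simp
  then show ?thesis
    using a step by (auto simp: carrier_Gamma0 Gamma0_power_def)
qed

text \<open>Written in terms of coordinate 0, the last relation says that its d-th power is 1, up to
  an inversion depending on the parity of the length.\<close>

lemma Gamma0_power_surj:
  assumes "l \<in> carrier (Gamma0 a)"
  shows "\<exists>m. l = Gamma0_power a m"
proof -
  let ?n = "length a" and ?d = "int (prod_list a)"
  have l0: "l 0 \<noteq> 0"
    using assms a by (auto simp: carrier_Gamma0)
  have n: "Suc (?n - 1) = ?n"
    using a by simp
  have "1 = (l 0 powi weight a (?n - 1)) powi int (a ! (?n - 1))"
    using assms Gamma0_coordinate[OF assms, of "?n - 1"] a by (auto simp: carrier_Gamma0)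
  also have "\<dots> = l 0 powi (- weight a ?n)"
    using weight_Suc[of a "?n - 1", unfolded n] l0 by (simp add: power_int_mult mult.commute)
  also have "- weight a ?n = - ((- 1) ^ ?n) * ?d"
    by (simp add: weight_length)
  finally have 1: "l 0 powi (- ((- 1) ^ ?n) * ?d) = 1"
    by simp
  have "l 0 powi ?d = 1"
  proof (cases "even ?n")
    case True
    with 1 show ?thesis
      by (simp add: power_int_minus)
  qed (use 1 in simp)
  then obtain m where m: "l 0 = root_of_unity ?d m"
    using root_of_unity_surj[of ?d "l 0"] pos by auto
  have "l = Gamma0_power a m"
  proof (rule extensionalityI)
    show "l \<in> extensional {..<?n}"
      using assms by (simp add: carrier_Gamma0)
    show "l i = Gamma0_power a m i" if "i \<in> {..<?n}" for i
      using that Gamma0_coordinate[OF assms, of i]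
      by (simp add: Gamma0_power_def m root_of_unity_power_int mult.commute)
  qed (simp add: Gamma0_power_def)
  then show ?thesis ..
qed

lemma Gamma0_power_add: "Gamma0_power a m \<otimes>\<^bsub>Gamma0 a\<^esub> Gamma0_power a k = Gamma0_power a (m + k)"
  by (auto simp: mult_Gamma0 Gamma0_power_def ring_distribs root_of_unity_add)

lemma Gamma0_power_0: "Gamma0_power a 0 = \<one>\<^bsub>Gamma0 a\<^esub>"
  by (simp add: Gamma0_power_def one_Gamma0)

lemma Gamma0_power_at_0: "Gamma0_power a m 0 = root_of_unity (int (prod_list a)) m"
  using a by (simp add: Gamma0_power_def)

lemma Gamma0_power_eq_one_iff: "Gamma0_power a m = \<one>\<^bsub>Gamma0 a\<^esub> \<longleftrightarrow> int (prod_list a) dvd m"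
proof
  assume "Gamma0_power a m = \<one>\<^bsub>Gamma0 a\<^esub>"
  then have "Gamma0_power a m 0 = 1"
    using a by (simp add: one_Gamma0)
  then show "int (prod_list a) dvd m"
    using pos by (simp add: Gamma0_power_at_0 root_of_unity_eq_1_iff)
next
  assume "int (prod_list a) dvd m"
  then have "root_of_unity (int (prod_list a)) (m * w) = 1" for w
    using pos by (simp add: root_of_unity_eq_1_iff)
  then show "Gamma0_power a m = \<one>\<^bsub>Gamma0 a\<^esub>"
    by (simp add: Gamma0_power_def one_Gamma0)
qed

lemma Gamma0_power_epi: "Gamma0_power a \<in> epi integer_group (Gamma0 a)"
proof -
  have "range (Gamma0_power a) = carrier (Gamma0 a)"
    using Gamma0_power_in_carrier Gamma0_power_surj by blast
  then show ?thesis
    by (auto simp: epi_def hom_def Gamma0_power_add)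
qed

lemma group_Gamma0: "group (Gamma0 a)"
  using group_epi_image[OF group_integer_group Gamma0_power_epi] Gamma0_power_0 by simp

text \<open>Existence in the definite description comes from \<open>Gamma0_power_surj\<close>,
  uniqueness from the fact that coordinate 0 determines the others.\<close>

lemma Gamma0_gen_eq: "Gamma0_gen a = Gamma0_power a 1"
proof -
  interpret group "Gamma0 a"
    by (rule group_Gamma0)
  interpret h: group_hom integer_group "Gamma0 a" "Gamma0_power a"
    using Gamma0_power_epi by (simp add: group_hom_def group_hom_axioms_def group_Gamma0 epi_def)
  have gen: "generate (Gamma0 a) {Gamma0_power a 1} = carrier (Gamma0 a)"
  proof -
    have pow: "Gamma0_power a m = Gamma0_power a 1 [^]\<^bsub>Gamma0 a\<^esub> m" for m
      using h.hom_int_pow[of 1 m] by simp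
    have "carrier (Gamma0 a) \<subseteq> generate (Gamma0 a) {Gamma0_power a 1}"
    proof
      fix l assume "l \<in> carrier (Gamma0 a)"
      then obtain m where "l = Gamma0_power a m"
        using Gamma0_power_surj by blast
      then show "l \<in> generate (Gamma0 a) {Gamma0_power a 1}"
        using pow[of m] generate_pow[OF Gamma0_power_in_carrier[of 1]] by blast
    qed
    then show ?thesis
      using generate_incl[of "{Gamma0_power a 1}"] Gamma0_power_in_carrier by auto
  qed
  have at0: "Gamma0_power a 1 0 = exp (2 * of_real pi * \<i> / of_nat (prod_list a))"
    by (simp add: Gamma0_power_at_0 root_of_unity_def cis_conv_exp mult_ac)
  show ?thesis
    unfolding Gamma0_gen_def
  proof (rule the_equality)
    fix l assume l: "l \<in> carrier (Gamma0 a) \<and> generate (Gamma0 a) {l} = carrier (Gamma0 a) \<and>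
      l 0 = exp (2 * of_real pi * \<i> / of_nat (prod_list a))"
    then have "l i = Gamma0_power a 1 i" if "i < length a" for i
      using Gamma0_coordinate[of l a i] Gamma0_coordinate[of "Gamma0_power a 1" a i]
        Gamma0_power_in_carrier that at0 by simp
    moreover have "l \<in> extensional {..<length a}" "Gamma0_power a 1 \<in> extensional {..<length a}"
      using l by (auto simp: carrier_Gamma0 Gamma0_power_def)
    ultimately show "l = Gamma0_power a 1"
      by (intro extensionalityI) auto
  qed (use gen at0 Gamma0_power_in_carrier in auto)
qed

end

section \<open>The dual group of characters\<close>

lemma group_cstar: "group cstar"
proof (rule groupI)
  fix z assume "z \<in> carrier cstar"
  then show "\<exists>w\<in>carrier cstar. w \<otimes>\<^bsub>cstar\<^esub> z = \<one>\<^bsub>cstar\<^esub>"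
    by (intro bexI[of _ "inverse z"]) (auto simp: cstar_def)
qed (auto simp: cstar_def)

text \<open>The character of m\<tau>. Since x_0 acts by \<open>l 0\<close> and \<tau> is (-1)^n x_0,
  the sign enters the exponent.\<close>

definition L0_power :: "nat list \<Rightarrow> int \<Rightarrow> (nat \<Rightarrow> complex) \<Rightarrow> complex" where
  "L0_power b m = (\<lambda>l\<in>carrier (Gamma0 b). l 0 powi ((- 1) ^ length b * m))"

context
  fixes b :: "nat list"
  assumes b: "b \<noteq> []" and pos: "prod_list b > 0"
begin

lemma L0_power_eq:
  "L0_power b m (Gamma0_power b k) = root_of_unity (int (prod_list b)) ((- 1) ^ length b * m * k)"
  using Gamma0_power_in_carrier[OF b pos]
  by (simp add: L0_power_def Gamma0_power_at_0[OF b pos] root_of_unity_power_int)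

text \<open>Characters may be compared on the elements \<open>Gamma0_power b k\<close>, which
  exhaust the group.\<close>

lemma L0_power_eqI:
  assumes "c \<in> extensional (carrier (Gamma0 b))"
    and "\<And>k. c (Gamma0_power b k) = root_of_unity (int (prod_list b)) ((- 1) ^ length b * m * k)"
  shows "c = L0_power b m"
proof (rule extensionalityI)
  fix l assume "l \<in> carrier (Gamma0 b)"
  then obtain k where "l = Gamma0_power b k"
    using Gamma0_power_surj[OF b pos] by blast
  then show "c l = L0_power b m l"
    by (simp add: assms(2) L0_power_eq)
qed (use assms(1) in \<open>auto simp: L0_power_def\<close>)

lemma L0_power_in_carrier: "L0_power b m \<in> carrier (L0 b)"
proof -
  have "L0_power b m \<in> hom (Gamma0 b) cstar"
  proof (rule homI)
    fix l l' assume l: "l \<in> carrier (Gamma0 b)" and l': "l' \<in> carrier (Gamma0 b)"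
    then obtain k k' where k: "l = Gamma0_power b k" "l' = Gamma0_power b k'"
      using Gamma0_power_surj[OF b pos] by blast
    show "L0_power b m l \<in> carrier cstar"
      by (simp add: k L0_power_eq cstar_def)
    show "L0_power b m (l \<otimes>\<^bsub>Gamma0 b\<^esub> l') = L0_power b m l \<otimes>\<^bsub>cstar\<^esub> L0_power b m l'"
      by (simp add: k Gamma0_power_add[OF b pos] L0_power_eq cstar_def ring_distribs root_of_unity_add)
  qed
  then show ?thesis
    by (simp add: L0_def L0_power_def)
qed

lemma L0_power_add: "L0_power b m \<otimes>\<^bsub>L0 b\<^esub> L0_power b k = L0_power b (m + k)"
  by (rule L0_power_eqI)
    (simp_all add: L0_def L0_power_eq Gamma0_power_in_carrier[OF b pos] ring_distribs root_of_unity_add)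

lemma L0_power_0: "L0_power b 0 = \<one>\<^bsub>L0 b\<^esub>"
  by (simp add: L0_power_def L0_def)

lemma L0_power_eq_one_iff: "L0_power b m = \<one>\<^bsub>L0 b\<^esub> \<longleftrightarrow> int (prod_list b) dvd m"
proof
  assume "L0_power b m = \<one>\<^bsub>L0 b\<^esub>"
  then have "L0_power b m (Gamma0_power b 1) = L0_power b 0 (Gamma0_power b 1)"
    by (simp add: L0_power_0)
  then have "int (prod_list b) dvd (- 1) ^ length b * m"
    using pos by (simp add: L0_power_eq root_of_unity_eq_1_iff)
  then show "int (prod_list b) dvd m"
    by (cases "even (length b)") simp_all
next
  assume dvd: "int (prod_list b) dvd m"
  have "L0_power b m = L0_power b 0"
  proof (rule L0_power_eqI)
    fix k
    have "root_of_unity (int (prod_list b)) ((- 1) ^ length b * m * k) = 1"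
      using dvd pos by (simp add: root_of_unity_eq_1_iff)
    then show "L0_power b m (Gamma0_power b k) =
        root_of_unity (int (prod_list b)) ((- 1) ^ length b * 0 * k)"
      by (simp add: L0_power_eq)
  qed (simp add: L0_power_def)
  then show "L0_power b m = \<one>\<^bsub>L0 b\<^esub>"
    by (simp add: L0_power_0)
qed

text \<open>A character of a cyclic group is fixed by its value \<open>z\<close> at the generator,
  and \<open>z\<close> is a d-th root of unity.\<close>

lemma L0_power_surj:
  assumes c: "c \<in> carrier (L0 b)"
  shows "\<exists>m. c = L0_power b m"
proof -
  let ?d = "int (prod_list b)"
  have "group_hom integer_group cstar (\<lambda>k. c (Gamma0_power b k))"
    using c Gamma0_power_in_carrier[OF b pos] group_cstar
    by (auto simp: group_hom_def group_hom_axioms_def L0_def hom_def Pi_iff simp flip: Gamma0_power_add[OF b pos])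
  then interpret h: group_hom integer_group cstar "\<lambda>k. c (Gamma0_power b k)" .
  define z where "z = c (Gamma0_power b 1)"
  have z: "z \<noteq> 0"
    using h.hom_closed[of 1] by (simp add: z_def cstar_def)
  have "c (Gamma0_power b (int k)) = z ^ k" for k
  proof (induction k)
    case 0
    then show ?case using h.hom_one by (simp add: cstar_def)
  next
    case (Suc k)
    then show ?case using h.hom_mult[of 1 "int k"] by (simp add: cstar_def z_def)
  qed
  moreover have "c (Gamma0_power b (- k)) = inverse (c (Gamma0_power b k))" for k
  proof -
    have "c (Gamma0_power b k) * c (Gamma0_power b (- k)) = 1"
      using h.hom_mult[of k "- k"] h.hom_one by (simp add: cstar_def)
    then show ?thesis
      by (metis inverse_unique)
  qed
  ultimately have ck: "c (Gamma0_power b k) = z powi k" for k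
    by (cases k rule: int_cases4) (simp_all add: power_int_minus)
  have "Gamma0_power b ?d = Gamma0_power b 0"
    using Gamma0_power_eq_one_iff[OF b pos, of ?d] Gamma0_power_0[OF b pos] by simp
  then have "z ^ nat ?d = 1"
    using ck[of ?d] ck[of 0] by simp
  then obtain m where m: "z = root_of_unity ?d m"
    using root_of_unity_surj[of ?d z] pos by auto
  \<comment> \<open>The extra sign cancels the one built into \<open>L0_power\<close>.\<close>
  have "c = L0_power b ((- 1) ^ length b * m)"
  proof (rule L0_power_eqI)
    show "c \<in> extensional (carrier (Gamma0 b))"
      using c by (simp add: L0_def)
    show "c (Gamma0_power b k) = root_of_unity ?d ((- 1) ^ length b * ((- 1) ^ length b * m) * k)" for k
      by (simp add: ck m root_of_unity_power_int mult.commute[of m])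
  qed
  then show ?thesis ..
qed

lemma L0_power_epi: "L0_power b \<in> epi integer_group (L0 b)"
proof -
  have "range (L0_power b) = carrier (L0 b)"
    using L0_power_in_carrier L0_power_surj by blast
  then show ?thesis
    by (auto simp: epi_def hom_def L0_power_add)
qed

lemma group_L0: "group (L0 b)"
  using group_epi_image[OF group_integer_group L0_power_epi] L0_power_0 by simp

end

section \<open>The group with \<open>T\<close> adjoined\<close>

text \<open>\<open>x\<^sub>i = weight b i \<cdot> x\<^sub>0 + T_coeff b i \<cdot> T\<close> in \<open>Ltilde b\<close>.\<close>

primrec T_coeff :: "nat list \<Rightarrow> nat \<Rightarrow> int" where
  "T_coeff b 0 = 0"
| "T_coeff b (Suc i) = 2 - int (b ! i) * T_coeff b i"

lemma T_coeff_append: "i \<le> length b \<Longrightarrow> T_coeff (b @ c) i = T_coeff b i"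
  by (induction i) (simp_all add: nth_append)

text \<open>Unfolding the recursion gives 2(1 - b_n(1 - b_{n-1}(...))), a Horner scheme whose
  products start at the last entry. Appending an entry to \<open>b\<close> prepends it to
  \<open>rev b\<close>, so induction from the right peels off the outermost factor.\<close>

lemma T_coeff_length: "T_coeff b (length b) = 2 * (\<Sum>i<length b. weight (rev b) i)"
proof (induction b rule: rev_induct)
  case (snoc x b)
  have "(\<Sum>i<Suc (length b). weight (x # rev b) i) = 1 - int x * (\<Sum>i<length b. weight (rev b) i)"
    by (subst sum.lessThan_Suc_shift) (simp add: weight_Cons_Suc sum_distrib_left sum_negf del: weight_Suc)
  then show ?case
    using snoc by (simp add: T_coeff_append algebra_simps del: sum.lessThan_Suc)
qed simp

text \<open>With \<open>T_part\<close>, the homomorphism from the free group to Z^2 that eliminates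
  every generator except x_0 and T. Being defined on coefficients, it can be evaluated on relators
  before any quotient is formed.\<close>

definition X0_part :: "nat list \<Rightarrow> (L_generator \<Rightarrow>\<^sub>0 int) \<Rightarrow> int" where
  "X0_part b c = (\<Sum>i<length b. weight b i * Poly_Mapping.lookup c (Xgen i))"

definition T_part :: "nat list \<Rightarrow> (L_generator \<Rightarrow>\<^sub>0 int) \<Rightarrow> int" where
  "T_part b c = (\<Sum>i<length b. T_coeff b i * Poly_Mapping.lookup c (Xgen i)) +
     2 * Poly_Mapping.lookup c Pgen + Poly_Mapping.lookup c Tgen"

lemma X0_part_add: "X0_part b (c + c') = X0_part b c + X0_part b c'"
  and X0_part_diff: "X0_part b (c - c') = X0_part b c - X0_part b c'"
  and X0_part_minus: "X0_part b (- c) = - X0_part b c"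
  and X0_part_cmul: "X0_part b (frag_cmul k c) = k * X0_part b c"
  and X0_part_0: "X0_part b 0 = 0"
  and X0_part_gens: "X0_part b (frag_of Pgen) = 0" "X0_part b (frag_of Tgen) = 0"
    "X0_part b (frag_of (Xgen i)) = (if i < length b then weight b i else 0)"
  by (simp_all add: X0_part_def lookup_add lookup_minus ring_distribs sum.distrib sum_subtractf
      sum_negf sum_distrib_left mult_ac if_distrib cong: if_cong)

lemma T_part_add: "T_part b (c + c') = T_part b c + T_part b c'"
  and T_part_diff: "T_part b (c - c') = T_part b c - T_part b c'"
  and T_part_minus: "T_part b (- c) = - T_part b c"
  and T_part_cmul: "T_part b (frag_cmul k c) = k * T_part b c"
  and T_part_0: "T_part b 0 = 0"
  and T_part_gens: "T_part b (frag_of Pgen) = 2" "T_part b (frag_of Tgen) = 1"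
    "T_part b (frag_of (Xgen i)) = (if i < length b then T_coeff b i else 0)"
  by (simp_all add: T_part_def lookup_add lookup_minus ring_distribs sum.distrib sum_subtractf
      sum_negf sum_distrib_left mult_ac if_distrib cong: if_cong)

lemmas X0_part_simps = X0_part_add X0_part_diff X0_part_minus X0_part_cmul X0_part_0 X0_part_gens
lemmas T_part_simps = T_part_add T_part_diff T_part_minus T_part_cmul T_part_0 T_part_gens

definition X0_T_comb :: "int \<Rightarrow> int \<Rightarrow> L_generator \<Rightarrow>\<^sub>0 int" where
  "X0_T_comb m k = frag_cmul m (frag_of (Xgen 0)) + frag_cmul k (frag_of Tgen)"

lemma X0_T_comb_add: "X0_T_comb m k + X0_T_comb m' k' = X0_T_comb (m + m') (k + k')"
  and X0_T_comb_diff: "X0_T_comb m k - X0_T_comb m' k' = X0_T_comb (m - m') (k - k')"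
  and X0_T_comb_cmul: "frag_cmul r (X0_T_comb m k) = X0_T_comb (r * m) (r * k)"
  by (rule poly_mapping_eqI; simp add: X0_T_comb_def lookup_add lookup_minus algebra_simps)+

text \<open>The class of m\<tau> + kT; the sign translates \<tau> into x_0.\<close>

definition tau_T_class :: "nat list \<Rightarrow> int \<times> int \<Rightarrow> (L_generator \<Rightarrow>\<^sub>0 int) set" where
  "tau_T_class b = (\<lambda>(m, k). Ltilde_class b (X0_T_comb ((- 1) ^ length b * m) k))"

context
  fixes b :: "nat list"
  assumes b: "b \<noteq> []" and pos: "prod_list b > 0"
begin

section \<open>The subgroup of relations and reduction to x_0 and T\<close>

lemma relators_subset:
  "L_relators b \<union> {frag_cmul 2 (frag_of Tgen) - frag_of Pgen} \<subseteq> carrier (Ltilde_free b)"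
proof -
  have "length b - 1 < length b"
    using b by simp
  then show ?thesis
    unfolding Ltilde_free_def L_relators_def
    by (auto dest!: subsetD[OF keys_diff] subsetD[OF keys_add])
qed

lemma Ltilde_relations_subgroup: "subgroup (Ltilde_relations b) (Ltilde_free b)"
  unfolding Ltilde_relations_def
  by (rule group.generate_is_subgroup[OF _ relators_subset]) (simp add: Ltilde_free_def)

lemma Ltilde_relations_closed:
  shows "0 \<in> Ltilde_relations b"
    and "c \<in> Ltilde_relations b \<Longrightarrow> c' \<in> Ltilde_relations b \<Longrightarrow> c + c' \<in> Ltilde_relations b"
    and "c \<in> Ltilde_relations b \<Longrightarrow> - c \<in> Ltilde_relations b"
    and "c \<in> Ltilde_relations b \<Longrightarrow> c' \<in> Ltilde_relations b \<Longrightarrow> c - c' \<in> Ltilde_relations b"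
    and "c \<in> Ltilde_relations b \<Longrightarrow> frag_cmul r c \<in> Ltilde_relations b"
proof -
  note N = Ltilde_relations_subgroup
  show 0: "0 \<in> Ltilde_relations b"
    using subgroup.one_closed[OF N] by (simp add: Ltilde_free_def)
  show add: "c + c' \<in> Ltilde_relations b" if "c \<in> Ltilde_relations b" "c' \<in> Ltilde_relations b" for c c'
    using subgroup.m_closed[OF N that] by (simp add: Ltilde_free_def)
  show minus: "- c \<in> Ltilde_relations b" if "c \<in> Ltilde_relations b" for c
    using subgroup.m_inv_closed[OF N that] subgroup.mem_carrier[OF N that] by (simp add: Ltilde_free_def)
  show "c - c' \<in> Ltilde_relations b" if "c \<in> Ltilde_relations b" "c' \<in> Ltilde_relations b"
    using add[OF that(1) minus[OF that(2)]] by simp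
  assume c: "c \<in> Ltilde_relations b"
  have "frag_cmul (int k) c \<in> Ltilde_relations b" for k
    by (induction k) (use 0 add c in \<open>auto simp: frag_cmul_distrib\<close>)
  then show "frag_cmul r c \<in> Ltilde_relations b"
    using minus by (cases r rule: int_cases2) (fastforce simp flip: minus_frag_cmul)+
qed

text \<open>This bounds the relations from above: there are none between x_0 and T beyond multiples
  of the final one. Both functionals vanish on every relator except the last, and they are
  additive.\<close>

lemma Ltilde_relations_parts:
  assumes "c \<in> Ltilde_relations b"
  shows "\<exists>r. X0_part b c = weight b (length b) * r \<and> T_part b c = T_coeff b (length b) * r"
  using assms unfolding Ltilde_relations_def
proof (induction rule: generate.induct)
  case one
  show ?case by (intro exI[of _ 0]) (simp add: Ltilde_free_def X0_part_simps T_part_simps)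
next
  have n: "Suc (length b - 1) = length b"
    using b by simp
  have *: "\<exists>r. X0_part b h = weight b (length b) * r \<and> T_part b h = T_coeff b (length b) * r"
    if "h \<in> L_relators b \<union> {frag_cmul 2 (frag_of Tgen) - frag_of Pgen}" for h
  proof -
    consider i where "Suc i < length b"
        "h = frag_cmul (int (b ! i)) (frag_of (Xgen i)) + frag_of (Xgen (Suc i)) - frag_of Pgen"
      | "h = frag_cmul (int (b ! (length b - 1))) (frag_of (Xgen (length b - 1))) - frag_of Pgen"
      | "h = frag_cmul 2 (frag_of Tgen) - frag_of Pgen"
      using \<open>h \<in> _\<close> unfolding L_relators_def by blast
    then show ?thesis
    proof cases
      case 1
      then show ?thesis by (intro exI[of _ 0]) (simp add: X0_part_simps T_part_simps)
    next
      case 2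
      \<comment> \<open>The last relator is the negative of the final relation after elimination: by
        the recursions, b_n times the last weight is minus the next weight, and b_n times the last
        T-coefficient minus 2 is minus the next T-coefficient.\<close>
      then show ?thesis
        using weight_Suc[of b "length b - 1"] T_coeff.simps(2)[of b "length b - 1"] b
        by (intro exI[of _ "- 1"]) (simp add: X0_part_simps T_part_simps n)
    next
      case 3
      then show ?thesis by (intro exI[of _ 0]) (simp add: X0_part_simps T_part_simps)
    qed
  qed
  {
    case (incl h)
    then show ?case by (rule *)
  next
    case (inv h)
    then have "h \<in> carrier (Ltilde_free b)"
      using relators_subset by blast
    then have "inv\<^bsub>Ltilde_free b\<^esub> h = - h"
      by (simp add: Ltilde_free_def)
    moreover obtain r where "X0_part b h = weight b (length b) * r \<and> T_part b h = T_coeff b (length b) * r"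
      using *[OF inv] by blast
    ultimately show ?case by (intro exI[of _ "- r"]) (simp add: X0_part_simps T_part_simps)
  next
    case (eng h1 h2)
    then obtain r1 r2 where
      "X0_part b h1 = weight b (length b) * r1 \<and> T_part b h1 = T_coeff b (length b) * r1"
      "X0_part b h2 = weight b (length b) * r2 \<and> T_part b h2 = T_coeff b (length b) * r2"
      by blast
    then show ?case
      by (intro exI[of _ "r1 + r2"]) (simp add: Ltilde_free_def X0_part_simps T_part_simps ring_distribs)
  }
qed

text \<open>The relation b_i x_i + x_{i+1} = p = 2T solves for x_{i+1}, and the induction hypothesis
  is substituted for x_i.\<close>

lemma Xgen_relation:
  "i < length b \<Longrightarrow> frag_of (Xgen i) - X0_T_comb (weight b i) (T_coeff b i) \<in> Ltilde_relations b"
proof (induction i)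
  case 0
  then show ?case using Ltilde_relations_closed(1) by (simp add: X0_T_comb_def)
next
  case (Suc i)
  let ?r = "frag_cmul (int (b ! i)) (frag_of (Xgen i)) + frag_of (Xgen (Suc i)) - frag_of Pgen"
  let ?t = "frag_cmul 2 (frag_of Tgen) - frag_of Pgen"
  let ?x = "frag_of (Xgen i) - X0_T_comb (weight b i) (T_coeff b i)"
  have r: "?r \<in> Ltilde_relations b" and t: "?t \<in> Ltilde_relations b"
    using Suc.prems unfolding Ltilde_relations_def L_relators_def by (auto intro!: generate.incl)
  have "?x \<in> Ltilde_relations b"
    using Suc by simp
  \<comment> \<open>Subtracting b_i times the hypothesis removes x_i, and subtracting 2T - p
    exchanges p for 2T.\<close>
  from Ltilde_relations_closed(4)[OF Ltilde_relations_closed(4)[OF r Ltilde_relations_closed(5)[OF this]] t]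
  have "?r - frag_cmul (int (b ! i)) ?x - ?t \<in> Ltilde_relations b"
    .
  also have "?r - frag_cmul (int (b ! i)) ?x - ?t =
      frag_of (Xgen (Suc i)) - X0_T_comb (weight b (Suc i)) (T_coeff b (Suc i))"
    by (rule poly_mapping_eqI) (simp add: X0_T_comb_def lookup_add lookup_minus algebra_simps)
  finally show ?case .
qed

text \<open>One more step of the same elimination, with the absent generator after the last one read
  as 0.\<close>

lemma final_relation: "X0_T_comb (weight b (length b)) (T_coeff b (length b)) \<in> Ltilde_relations b"
proof -
  obtain i where i: "length b = Suc i"
    using b by (cases b) auto
  let ?r = "frag_cmul (int (b ! i)) (frag_of (Xgen i)) - frag_of Pgen"
  let ?t = "frag_cmul 2 (frag_of Tgen) - frag_of Pgen"
  let ?x = "frag_of (Xgen i) - X0_T_comb (weight b i) (T_coeff b i)"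
  have r: "?r \<in> Ltilde_relations b" and t: "?t \<in> Ltilde_relations b"
    unfolding Ltilde_relations_def L_relators_def by (auto intro!: generate.incl simp: i)
  have "?x \<in> Ltilde_relations b"
    using Xgen_relation i by simp
  from Ltilde_relations_closed(2)[OF Ltilde_relations_closed(4)[OF Ltilde_relations_closed(5)[OF this] r] t]
  have "frag_cmul (int (b ! i)) ?x - ?r + ?t \<in> Ltilde_relations b"
    .
  also have "frag_cmul (int (b ! i)) ?x - ?r + ?t = X0_T_comb (weight b (length b)) (T_coeff b (length b))"
    by (rule poly_mapping_eqI) (simp add: X0_T_comb_def lookup_add lookup_minus algebra_simps i)
  finally show ?thesis .
qed

text \<open>The difference is additive in \<open>c\<close>, so only generators need checking: x_i is
  covered by \<open>Xgen_relation\<close>, p by p = 2T, and T is already in normal form.\<close>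

lemma reduce_to_X0_T:
  assumes "c \<in> carrier (Ltilde_free b)"
  shows "c - X0_T_comb (X0_part b c) (T_part b c) \<in> Ltilde_relations b"
proof -
  have "Poly_Mapping.keys c \<subseteq> Xgen ` {..<length b} \<union> {Pgen, Tgen}"
    using assms by (simp add: Ltilde_free_def)
  then show ?thesis
  proof (rule free_Abelian_group_induct
      [where P = "\<lambda>c. c - X0_T_comb (X0_part b c) (T_part b c) \<in> Ltilde_relations b"])
    show "0 - X0_T_comb (X0_part b 0) (T_part b 0) \<in> Ltilde_relations b"
      using Ltilde_relations_closed(1) by (simp add: X0_part_simps T_part_simps X0_T_comb_def)
  next
    fix x y assume xy: "x - X0_T_comb (X0_part b x) (T_part b x) \<in> Ltilde_relations b"
      "y - X0_T_comb (X0_part b y) (T_part b y) \<in> Ltilde_relations b"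
    have "X0_T_comb (X0_part b (x - y)) (T_part b (x - y)) =
        X0_T_comb (X0_part b x) (T_part b x) - X0_T_comb (X0_part b y) (T_part b y)"
      by (simp add: X0_part_diff T_part_diff X0_T_comb_diff)
    then have eq: "(x - X0_T_comb (X0_part b x) (T_part b x)) - (y - X0_T_comb (X0_part b y) (T_part b y)) =
        (x - y) - X0_T_comb (X0_part b (x - y)) (T_part b (x - y))"
      by (simp only: algebra_simps)
    then show "(x - y) - X0_T_comb (X0_part b (x - y)) (T_part b (x - y)) \<in> Ltilde_relations b"
      using Ltilde_relations_closed(4)[OF xy] by (simp only: eq)
  next
    fix g assume "g \<in> Xgen ` {..<length b} \<union> {Pgen, Tgen}"
    then consider i where "i < length b" "g = Xgen i" | "g = Pgen" | "g = Tgen"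
      by auto
    then show "frag_of g - X0_T_comb (X0_part b (frag_of g)) (T_part b (frag_of g)) \<in> Ltilde_relations b"
    proof cases
      case 1
      then show ?thesis using Xgen_relation by (simp add: X0_part_simps T_part_simps)
    next
      case 2
      have "frag_cmul 2 (frag_of Tgen) - frag_of Pgen \<in> Ltilde_relations b"
        unfolding Ltilde_relations_def by (auto intro!: generate.incl)
      from Ltilde_relations_closed(3)[OF this] show ?thesis
        by (simp add: 2 X0_part_simps T_part_simps X0_T_comb_def)
    next
      case 3
      then show ?thesis
        using Ltilde_relations_closed(1) by (simp add: X0_part_simps T_part_simps X0_T_comb_def)
    qed
  qed
qed

section \<open>Cosets, their characters, and the presentation by \<tau> and T\<close>

lemma normal_Ltilde_relations: "normal (Ltilde_relations b) (Ltilde_free b)"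
  using comm_group.subgroup_imp_normal[OF _ Ltilde_relations_subgroup] abelian_free_Abelian_group
  by (auto simp: Ltilde_free_def)

lemma group_Ltilde: "group (Ltilde b)"
  unfolding Ltilde_def by (rule normal.factorgroup_is_group[OF normal_Ltilde_relations])

lemma Ltilde_class_epi: "Ltilde_class b \<in> epi (Ltilde_free b) (Ltilde b)"
  using normal.r_coset_hom_Mod[OF normal_Ltilde_relations]
  unfolding epi_def Ltilde_class_def[abs_def] Ltilde_def
  by (auto simp: FactGroup_def RCOSETS_def)

lemma X0_T_comb_in_carrier: "X0_T_comb m k \<in> carrier (Ltilde_free b)"
  using b unfolding X0_T_comb_def Ltilde_free_def
  by (auto dest!: subsetD[OF keys_add])

lemma Ltilde_class_eq_iff:
  assumes "c \<in> carrier (Ltilde_free b)" "c' \<in> carrier (Ltilde_free b)"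
  shows "Ltilde_class b c = Ltilde_class b c' \<longleftrightarrow> c - c' \<in> Ltilde_relations b"
proof -
  interpret normal "Ltilde_relations b" "Ltilde_free b"
    by (rule normal_Ltilde_relations)
  have "Ltilde_class b c = Ltilde_class b c' \<longleftrightarrow> c \<in> Ltilde_class b c'"
    using assms repr_independence[of c "Ltilde_relations b" c'] rcos_self[of c "Ltilde_relations b"]
      subgroup_axioms unfolding Ltilde_class_def by metis
  also have "\<dots> \<longleftrightarrow> c - c' \<in> Ltilde_relations b"
    unfolding Ltilde_class_def r_coset_def
    by (auto simp: Ltilde_free_def algebra_simps intro: bexI[of _ "c - c'"])
  finally show ?thesis .
qed

lemma one_Ltilde: "\<one>\<^bsub>Ltilde b\<^esub> = Ltilde_class b 0"
proof -
  have "Ltilde_class b 0 = Ltilde_relations b"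
    unfolding Ltilde_class_def r_coset_def by (simp add: Ltilde_free_def)
  then show ?thesis
    by (simp add: Ltilde_def FactGroup_def)
qed

text \<open>At the k-th power of the generator, x_i contributes the exponent k times
  \<open>weight b i\<close>; summed over i, these exponents form k times \<open>X0_part b c\<close>.
  The leading sign undoes the one in \<open>L0_power\<close>.\<close>

lemma L_character_eq: 
  assumes "c \<in> carrier (Ltilde_free b)"
  shows "L_character b c = L0_power b ((- 1) ^ length b * X0_part b c)"
proof (rule L0_power_eqI[OF b pos])
  fix k
  have "(\<Prod>i<length b. Gamma0_power b k i powi Poly_Mapping.lookup c (Xgen i)) =
      root_of_unity (int (prod_list b)) (X0_part b c * k)"
    by (simp add: Gamma0_power_def root_of_unity_power_int root_of_unity_prod X0_part_def
        sum_distrib_left mult_ac)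
  then show "L_character b c (Gamma0_power b k) = root_of_unity (int (prod_list b))
      ((- 1) ^ length b * ((- 1) ^ length b * X0_part b c) * k)"
    using Gamma0_power_in_carrier[OF b pos]
    by (simp add: L_character_def)
qed (simp add: L_character_def)

text \<open>Representatives differ by relations, whose \<open>X0_part\<close> is a multiple of d and
  hence has trivial character. So the image of a coset is a singleton and \<open>the_elem\<close> is
  meaningful.\<close>

lemma Ltilde_proj_class:
  assumes c: "c \<in> carrier (Ltilde_free b)"
  shows "Ltilde_proj b (Ltilde_class b c) = L0_power b ((- 1) ^ length b * X0_part b c)"
proof -
  let ?\<chi> = "L0_power b ((- 1) ^ length b * X0_part b c)"
  have "L_character b x = ?\<chi>" if x: "x \<in> Ltilde_class b c" for x
  proof -
    obtain h where h: "h \<in> Ltilde_relations b" "x = h + c"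
      using x by (auto simp: Ltilde_class_def r_coset_def Ltilde_free_def)
    have hc: "h \<in> carrier (Ltilde_free b)"
      using h Ltilde_relations_subgroup by (auto dest: subgroup.mem_carrier)
    have xc: "x \<in> carrier (Ltilde_free b)"
      using c h hc by (auto simp: Ltilde_free_def dest!: subsetD[OF keys_add])
    obtain r where "X0_part b h = weight b (length b) * r"
      using Ltilde_relations_parts h by blast
    then have "int (prod_list b) dvd (- 1) ^ length b * X0_part b h"
      by (simp add: weight_length)
    then have 1: "L0_power b ((- 1) ^ length b * X0_part b h) = L0_power b 0"
      using L0_power_eq_one_iff[OF b pos] L0_power_0[OF b pos] by metis
    have "L_character b x = L0_power b ((- 1) ^ length b * X0_part b h + (- 1) ^ length b * X0_part b c)"
      using L_character_eq[OF xc] by (simp only: h(2) X0_part_add ring_distribs)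
    \<comment> \<open>Additivity is used in both directions: the character of \<open>h\<close> is
      split off, replaced by that of 0, and merged again.\<close>
    then show ?thesis
      by (simp add: 1 L0_power_add[OF b pos] flip: L0_power_add[OF b pos, of "(- 1) ^ length b * X0_part b h"])
  qed
  moreover have "c \<in> Ltilde_class b c"
    using group.rcos_self[OF _ c Ltilde_relations_subgroup] normal_Ltilde_relations
    by (simp add: Ltilde_class_def normal_def)
  ultimately have "L_character b ` Ltilde_class b c = {?\<chi>}"
    by (auto simp: image_iff)
  then show ?thesis
    by (simp add: Ltilde_proj_def)
qed

lemma tau_T_class_epi: "tau_T_class b \<in> epi (integer_group \<times>\<times> integer_group) (Ltilde b)"
proof -
  have hom: "Ltilde_class b \<in> hom (Ltilde_free b) (Ltilde b)"
    and surj: "Ltilde_class b ` carrier (Ltilde_free b) = carrier (Ltilde b)"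
    using Ltilde_class_epi by (auto simp: epi_def)
  have "tau_T_class b (m, k) \<otimes>\<^bsub>Ltilde b\<^esub> tau_T_class b (m', k') = tau_T_class b (m + m', k + k')" for m k m' k'
    using hom_mult[OF hom X0_T_comb_in_carrier X0_T_comb_in_carrier]
    by (simp add: tau_T_class_def Ltilde_free_def X0_T_comb_add ring_distribs)
  moreover have "tau_T_class b mk \<in> carrier (Ltilde b)" for mk
    using surj X0_T_comb_in_carrier by (auto simp: tau_T_class_def split: prod.split)
  moreover have "carrier (Ltilde b) \<subseteq> range (tau_T_class b)"
  proof
    fix C assume "C \<in> carrier (Ltilde b)"
    then obtain c where c: "c \<in> carrier (Ltilde_free b)" "C = Ltilde_class b c"
      using surj by blast
    have "C = Ltilde_class b (X0_T_comb (X0_part b c) (T_part b c))"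
      using reduce_to_X0_T[OF c(1)] Ltilde_class_eq_iff[OF c(1) X0_T_comb_in_carrier] c(2) by simp
    also have "\<dots> = tau_T_class b ((- 1) ^ length b * X0_part b c, T_part b c)"
      by (simp add: tau_T_class_def)
    finally show "C \<in> range (tau_T_class b)"
      by simp
  qed
  ultimately show ?thesis
    by (auto simp: epi_def hom_def)
qed

text \<open>\<open>Ltilde_relations_parts\<close> shows that the kernel is no larger,
  \<open>final_relation\<close> that it is no smaller. The sign of \<tau> cancels against that of
  \<open>weight b (length b)\<close>.\<close>

lemma tau_T_class_eq_one_iff:
  "tau_T_class b (m, k) = \<one>\<^bsub>Ltilde b\<^esub> \<longleftrightarrow>
     (\<exists>r. m = int (prod_list b) * r \<and> k = T_coeff b (length b) * r)"
proof -
  have 0: "0 \<in> carrier (Ltilde_free b)"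
    by (simp add: Ltilde_free_def)
  have "tau_T_class b (m, k) = \<one>\<^bsub>Ltilde b\<^esub> \<longleftrightarrow> X0_T_comb ((- 1) ^ length b * m) k \<in> Ltilde_relations b"
    using Ltilde_class_eq_iff[OF X0_T_comb_in_carrier 0] by (simp add: tau_T_class_def one_Ltilde)
  also have "\<dots> \<longleftrightarrow> (\<exists>r. (- 1) ^ length b * m = weight b (length b) * r \<and> k = T_coeff b (length b) * r)"
  proof
    assume "X0_T_comb ((- 1) ^ length b * m) k \<in> Ltilde_relations b"
    then show "\<exists>r. (- 1) ^ length b * m = weight b (length b) * r \<and> k = T_coeff b (length b) * r"
      using Ltilde_relations_parts b by (fastforce simp: X0_T_comb_def X0_part_simps T_part_simps)
  next
    assume "\<exists>r. (- 1) ^ length b * m = weight b (length b) * r \<and> k = T_coeff b (length b) * r"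
    then show "X0_T_comb ((- 1) ^ length b * m) k \<in> Ltilde_relations b"
      using Ltilde_relations_closed(5)[OF final_relation] by (auto simp: X0_T_comb_cmul mult_ac)
  qed
  also have "\<dots> \<longleftrightarrow> (\<exists>r. m = int (prod_list b) * r \<and> k = T_coeff b (length b) * r)"
    by (simp add: weight_length mult.assoc)
  finally show ?thesis .
qed

lemma T_power_eq: "T_power b k = tau_T_class b (0, k)"
proof -
  have hom: "tau_T_class b \<in> hom (integer_group \<times>\<times> integer_group) (Ltilde b)"
    using tau_T_class_epi by (simp add: epi_def)
  have "(\<lambda>k. tau_T_class b (0, k)) \<in> hom integer_group (Ltilde b)"
  proof (rule homI)
    show "tau_T_class b (0, k) \<in> carrier (Ltilde b)" for k
      using hom_in_carrier[OF hom, of "(0, k)"] by simp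
    show "tau_T_class b (0, k \<otimes>\<^bsub>integer_group\<^esub> l) = tau_T_class b (0, k) \<otimes>\<^bsub>Ltilde b\<^esub> tau_T_class b (0, l)" for k l
      using hom_mult[OF hom, of "(0, k)" "(0, l)"] by simp
  qed
  then interpret h: group_hom integer_group "Ltilde b" "\<lambda>k. tau_T_class b (0, k)"
    using group_Ltilde by (simp add: group_hom_def group_hom_axioms_def)
  have "Ltilde_T b = tau_T_class b (0, 1)"
    by (simp add: Ltilde_T_def tau_T_class_def X0_T_comb_def)
  then show ?thesis
    using h.hom_int_pow[of 1 k] by (simp add: T_power_def)
qed

lemma Ltilde_tau_eq: "Ltilde_tau b = tau_T_class b (1, 0)"
  by (simp add: Ltilde_tau_def tau_T_class_def X0_T_comb_def)

lemma Ltilde_presented: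
  "presented_extension (int (prod_list b)) (T_coeff b (length b)) (Ltilde b) (L0 b)
     (T_power b) (Ltilde_proj b) (tau_T_class b) (L0_power b)"
proof -
  have "Ltilde_proj b (tau_T_class b (m, k)) = L0_power b m" for m k
    using b by (simp add: tau_T_class_def Ltilde_proj_class[OF X0_T_comb_in_carrier])
      (simp add: X0_T_comb_def X0_part_simps)
  then show ?thesis
    unfolding presented_extension_def
    by (simp add: group_Ltilde group_L0[OF b pos] tau_T_class_epi L0_power_epi[OF b pos]
        tau_T_class_eq_one_iff L0_power_eq_one_iff[OF b pos] T_power_eq)
qed

end

section \<open>Lagrangian frames and their phase\<close>

text \<open>Viewing a frame as a real-linear map turns independence into injectivity and the span
  into the range.\<close>

definition frame_map :: "complex ^ 'n ^ 'n \<Rightarrow> real ^ 'n \<Rightarrow> complex ^ 'n" where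
  "frame_map v x = (\<Sum>j\<in>UNIV. x $ j *\<^sub>R v $ j)"

lemma linear_frame_map: "linear (frame_map v)"
  by (rule linearI) (simp_all add: frame_map_def scaleR_add_left sum.distrib scaleR_sum_right)

lemma frame_map_axis [simp]: "frame_map v (axis j 1) = v $ j"
  by (simp add: frame_map_def axis_def if_distrib[of "\<lambda>c. c *\<^sub>R _"] cong: if_cong)

lemma frame_map_nth: "frame_map v x $ k = (\<Sum>j\<in>UNIV. of_real (x $ j) * v $ j $ k)"
  by (simp add: frame_map_def) (simp add: scaleR_conv_of_real)

lemma range_frame:
  fixes v :: "complex ^ 'n ^ 'n"
  shows "range (($) v) = frame_map v ` Basis"
proof -
  have Basis: "(Basis :: (real ^ 'n) set) = range (\<lambda>j. axis j 1)"
    by (auto simp: Basis_vec_def)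
  show ?thesis
    unfolding Basis image_image frame_map_axis ..
qed

lemma span_frame: "span (range (($) v)) = range (frame_map v)"
  unfolding range_frame by (simp add: linear_span_image linear_frame_map)

text \<open>Independence of a set cannot see repeated vectors; injectivity of the listing covers
  these, and injectivity of the linear map captures both conditions.\<close>

lemma is_basis_iff:
  fixes v :: "complex ^ 'n ^ 'n"
  shows "is_basis v \<Lambda> \<longleftrightarrow> inj (frame_map v) \<and> range (frame_map v) = \<Lambda>"
proof -
  have "inj (($) v) \<and> independent (range (($) v)) \<longleftrightarrow> inj (frame_map v)"
  proof
    assume v: "inj (($) v) \<and> independent (range (($) v))"
    have "inj_on (frame_map v) Basis"
    proof (rule inj_onI)
      fix x y :: "real ^ 'n" assume xy: "x \<in> Basis" "y \<in> Basis" "frame_map v x = frame_map v y"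
      then obtain i j where "x = axis i 1" "y = axis j 1"
        by (auto simp: Basis_vec_def)
      then show "x = y"
        using v xy by (auto dest: injD)
    qed
    then have "inj_on (frame_map v) (span Basis)"
      using v linear_inj_on_span_independent_image[OF linear_frame_map, of v Basis] by (simp add: range_frame)
    then show "inj (frame_map v)"
      by simp
  next
    assume inj: "inj (frame_map v)"
    have "inj (($) v)"
    proof (rule injI)
      fix i j assume "v $ i = v $ j"
      then have "axis i (1::real) = axis j 1"
        by (intro injD[OF inj]) simp
      then show "i = j"
        by (simp add: axis_eq_axis)
    qed
    moreover have "independent (range (($) v))"
      unfolding range_frame
      using linear_independent_injective_image[OF linear_frame_map independent_Basis] inj
      by (simp add: inj_on_subset)
    ultimately show "inj (($) v) \<and> independent (range (($) v))"
      by blast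
  qed
  then show ?thesis
    by (auto simp: is_basis_def span_frame)
qed

lemma symp_form_scale_complex: "symp_form (c *s u) (c *s w) = (cmod c)\<^sup>2 * symp_form u w"
proof -
  have "Im (cnj (c * x) * (c * y)) = (cmod c)\<^sup>2 * Im (cnj x * y)" for x y
  proof -
    have "cnj (c * x) * (c * y) = of_real ((cmod c)\<^sup>2) * (cnj x * y)"
      unfolding complex_norm_square by (simp add: mult_ac)
    then show ?thesis
      by (simp only: Im_complex_of_real) simp
  qed
  then show ?thesis
    by (simp add: symp_form_def sum_distrib_left)
qed

text \<open>Compatibility of the symplectic and complex structures: positivity prevents an isotropic
  subspace from containing both u and iu for nonzero u.\<close>

lemma symp_form_mult_i: "symp_form u (\<i> *s u) = (\<Sum>j\<in>UNIV. (cmod (u $ j))\<^sup>2)"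
  unfolding symp_form_def by (rule sum.cong) (simp_all add: cmod_power2 flip: power2_eq_square)

lemma lagrangian_range_iff:
  fixes v :: "complex ^ 'n ^ 'n"
  assumes "inj (frame_map v)"
  shows "lagrangian (range (frame_map v)) \<longleftrightarrow> (\<forall>x y. symp_form (frame_map v x) (frame_map v y) = 0)"
proof -
  have "dim (range (frame_map v)) = dim (UNIV :: (real ^ 'n) set)"
    using assms by (intro dim_image_eq linear_frame_map) simp
  then have "dim (range (frame_map v)) = CARD('n)"
    by simp
  then show ?thesis
    by (auto simp: lagrangian_def linear_subspace_image[OF linear_frame_map])
qed

lemma lagrangian_has_basis:
  assumes "lagrangian (\<Lambda> :: (complex ^ 'n) set)"
  obtains v where "is_basis v \<Lambda>"
proof -
  have sub: "subspace \<Lambda>" and dim: "dim \<Lambda> = CARD('n)"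
    using assms by (auto simp: lagrangian_def)
  obtain B where B: "B \<subseteq> \<Lambda>" "independent B" "\<Lambda> \<subseteq> span B" "card B = dim \<Lambda>"
    by (rule basis_exists)
  have "finite B"
    using B(2) by (rule finiteI_independent)
  then obtain h where h: "bij_betw h (UNIV :: 'n set) B"
    using finite_same_card_bij[of "UNIV :: 'n set" B] B(4) dim by auto
  let ?v = "(\<chi> j. h j) :: complex ^ 'n ^ 'n"
  have "(($) ?v) = h"
    by auto
  moreover have "span B = \<Lambda>"
    using B sub by (simp add: span_minimal subset_antisym)
  ultimately have "is_basis ?v \<Lambda>"
    using h B by (simp add: is_basis_def bij_betw_def)
  then show ?thesis ..
qed

text \<open>The vectors of a frame are rows, so a complex linear dependence among them is a left
  null vector; hence the passage to the transpose.\<close>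

lemma left_null_vector:
  fixes v :: "complex ^ 'n ^ 'n"
  shows "det v \<noteq> 0 \<longleftrightarrow> (\<forall>c. (\<forall>k. (\<Sum>j\<in>UNIV. c $ j * v $ j $ k) = 0) \<longrightarrow> c = 0)"
proof -
  have "det v \<noteq> 0 \<longleftrightarrow> (\<forall>c. transpose v *v c = 0 \<longrightarrow> c = 0)"
    using invertible_det_nz[of "transpose v"] matrix_left_invertible_ker[of "transpose v"]
    by (simp add: invertible_left_inverse)
  then show ?thesis
    by (simp add: vec_eq_iff matrix_vector_mult_def transpose_def mult.commute)
qed

lemma lagrangian_real: "lagrangian (range (\<lambda>x. \<chi> k. complex_of_real (x $ k)) :: (complex ^ 'n) set)"
proof -
  have "frame_map (\<chi> j. axis j 1) = (\<lambda>x. (\<chi> k. complex_of_real (x $ k)) :: complex ^ 'n)"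
    by (simp add: fun_eq_iff vec_eq_iff frame_map_nth axis_def if_distrib cong: if_cong)
  moreover have "inj (\<lambda>x. (\<chi> k. complex_of_real (x $ k)) :: complex ^ 'n)"
    by (rule injI) (simp add: vec_eq_iff)
  moreover have "symp_form (\<chi> k. complex_of_real (x $ k)) ((\<chi> k. complex_of_real (y $ k)) :: complex ^ 'n) = 0"
    for x y
    by (simp add: symp_form_def)
  ultimately show ?thesis
    using lagrangian_range_iff[of "(\<chi> j. axis j 1) :: complex ^ 'n ^ 'n"] by simp
qed

text \<open>Lagrangian subspaces are totally real. Splitting the coefficients of a complex
  dependence gives p + iq = 0 with p, q in \<Lambda>; then q = ip, and isotropy forces the norm of p
  to vanish.\<close>

lemma lagrangian_det_nonzero:
  fixes v :: "complex ^ 'n ^ 'n"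
  assumes v: "is_basis v \<Lambda>" and lag: "lagrangian \<Lambda>"
  shows "det v \<noteq> 0"
  unfolding left_null_vector
proof (intro allI impI)
  fix c :: "complex ^ 'n"
  assume c: "\<forall>k. (\<Sum>j\<in>UNIV. c $ j * v $ j $ k) = 0"
  define p q where "p = frame_map v (\<chi> j. Re (c $ j))" and "q = frame_map v (\<chi> j. Im (c $ j))"
  have pq: "p = - \<i> *s q"
  proof -
    have "p $ k + \<i> * q $ k = (\<Sum>j\<in>UNIV. c $ j * v $ j $ k)" for k
    proof -
      have "c $ j * v $ j $ k = of_real (Re (c $ j)) * v $ j $ k + \<i> * (of_real (Im (c $ j)) * v $ j $ k)"
        for j
        by (simp add: complex_eq_iff)
      then show ?thesis
        by (simp add: p_def q_def frame_map_nth sum_distrib_left sum.distrib)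
    qed
    then have "p $ k = - \<i> * q $ k" for k
      using c by (simp add: add_eq_0_iff2)
    then show ?thesis
      by (simp add: vec_eq_iff)
  qed
  have mem: "p \<in> \<Lambda>" "q \<in> \<Lambda>"
    using v by (auto simp: is_basis_iff p_def q_def)
  have "q = \<i> *s p"
    by (simp add: pq vec_eq_iff)
  then have "(\<Sum>j\<in>UNIV. (cmod (p $ j))\<^sup>2) = 0"
    using lag mem symp_form_mult_i[of p] by (simp add: lagrangian_def)
  then have "p = 0"
    by (simp add: sum_nonneg_eq_0_iff vec_eq_iff)
  then have "q = 0"
    using \<open>q = \<i> *s p\<close> by simp
  have "frame_map v 0 = 0"
    by (simp add: linear_0 linear_frame_map)
  then have "(\<chi> j. Re (c $ j)) = 0" "(\<chi> j. Im (c $ j)) = 0"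
    using \<open>p = 0\<close> \<open>q = 0\<close> v by (metis is_basis_iff injD p_def, metis is_basis_iff injD q_def)
  then show "c = 0"
    by (simp add: vec_eq_iff complex_eq_iff)
qed

lemma det_of_real: "det (\<chi> i j. complex_of_real (M $ i $ j)) = of_real (det M)"
  by (simp add: det_def)

text \<open>Two real bases differ by a real matrix, so the determinants differ by a nonzero real
  factor. Squaring and normalizing removes it, including its sign.\<close>

lemma lag_phase_eq:
  fixes v :: "complex ^ 'n ^ 'n"
  assumes v: "is_basis v \<Lambda>" and lag: "lagrangian \<Lambda>"
  shows "lag_phase \<Lambda> = (det v)\<^sup>2 / (of_real (cmod (det v)))\<^sup>2"
  unfolding lag_phase_def
proof (rule the_equality)
  show "\<exists>u. is_basis u \<Lambda> \<and> (det v)\<^sup>2 / (of_real (cmod (det v)))\<^sup>2 = (det u)\<^sup>2 / (of_real (cmod (det u)))\<^sup>2"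
    using v by blast
next
  fix z assume "\<exists>w. is_basis w \<Lambda> \<and> z = (det w)\<^sup>2 / (of_real (cmod (det w)))\<^sup>2"
  then obtain w where w: "is_basis w \<Lambda>" and z: "z = (det w)\<^sup>2 / (of_real (cmod (det w)))\<^sup>2"
    by blast
  have "\<exists>x. w $ j = frame_map v x" for j
  proof -
    have "w $ j \<in> \<Lambda>"
      using w frame_map_axis[of w j] by (metis is_basis_iff rangeI)
    then show ?thesis
      using v by (auto simp: is_basis_iff)
  qed
  then obtain X where X: "\<And>j. w $ j = frame_map v (X j)"
    by metis
  define M :: "real ^ 'n ^ 'n" where "M = (\<chi> j. X j)"
  have "w = (\<chi> i j. complex_of_real (M $ i $ j)) ** v"
    by (simp add: vec_eq_iff matrix_matrix_mult_def X frame_map_nth M_def)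
  then have "det w = of_real (det M) * det v"
    by (simp add: det_mul det_of_real)
  then show "z = (det v)\<^sup>2 / (of_real (cmod (det v)))\<^sup>2"
    using lagrangian_det_nonzero[OF w lag]
    by (simp add: z norm_mult power_mult_distrib flip: of_real_power)
qed

lemma lag_phase_nonzero: "lagrangian \<Lambda> \<Longrightarrow> lag_phase \<Lambda> \<noteq> 0"
  using lagrangian_has_basis[of \<Lambda>] lag_phase_eq[of _ \<Lambda>] lagrangian_det_nonzero[of _ \<Lambda>] by fastforce

section \<open>Connectedness of the Lagrangian bundle\<close>

text \<open>Paths of Lagrangian subspaces are constructed as paths of frames and pushed through this
  quotient map.\<close>

lemma continuous_map_span_frame:
  "continuous_map (top_of_set lagrangian_frames) lagrangian_grassmannian (\<lambda>v. span (range (($) v)))"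
  unfolding continuous_map_def
proof (intro conjI allI impI)
  show "(\<lambda>v. span (range (($) v))) \<in> topspace (top_of_set lagrangian_frames) \<rightarrow>
      topspace (lagrangian_grassmannian :: (complex ^ 'n) set topology)"
    by (auto simp: topspace_lagrangian_grassmannian lagrangian_frames_def is_basis_def)
qed (simp add: openin_lagrangian_grassmannian)

text \<open>The determinant of Re v + z Im v is a polynomial in z whose value at i is det v. It is
  therefore nonzero and has finitely many roots, so some real t avoids them; Re((1 - it)w) = Re w +
  t Im w links this to the claim.\<close>

lemma transversal_rotation:
  fixes v :: "complex ^ 'n ^ 'n"
  assumes "det v \<noteq> 0"
  obtains t :: real where "inj (\<lambda>x. \<chi> k. Re ((1 - \<i> * of_real t) * frame_map v x $ k))"
proof -
  define P where "P = (\<Sum>p\<in>{p. p permutes (UNIV :: 'n set)}. of_int (sign p) *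
    (\<Prod>i\<in>UNIV. [:of_real (Re (v $ i $ p i)), of_real (Im (v $ i $ p i)):] :: complex poly))"
  have P: "poly P z = det (\<chi> j k. of_real (Re (v $ j $ k)) + z * of_real (Im (v $ j $ k)))" for z
    by (simp add: P_def poly_sum poly_prod det_def)
  have "(\<chi> j k. of_real (Re (v $ j $ k)) + \<i> * of_real (Im (v $ j $ k))) = v"
    by (simp add: vec_eq_iff flip: complex_eq)
  then have "poly P \<i> \<noteq> 0"
    using assms by (simp add: P)
  then have "finite {z. poly P z = 0}"
    by (intro poly_roots_finite) auto
  then have "finite (of_real -` {z. poly P z = 0} :: real set)"
    by (rule finite_vimageI) (rule inj_of_real)
  then obtain t :: real where "poly P (of_real t) \<noteq> 0"
    using ex_new_if_finite[OF infinite_UNIV_char_0] by fastforce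
  then have det: "det (\<chi> j k. complex_of_real (Re (v $ j $ k) + t * Im (v $ j $ k))) \<noteq> 0"
    by (simp add: P)
  let ?f = "\<lambda>x. \<chi> k. Re ((1 - \<i> * of_real t) * frame_map v x $ k)"
  have "inj ?f"
  proof (subst linear_inj_iff_eq_0)
    show "linear ?f"
      by (rule linearI) (simp_all add: vec_eq_iff linear_add linear_scale linear_frame_map algebra_simps)
    show "\<forall>x. ?f x = 0 \<longrightarrow> x = 0"
    proof (intro allI impI)
      fix x assume x: "?f x = 0"
      have "(\<Sum>j\<in>UNIV. x $ j * (Re (v $ j $ k) + t * Im (v $ j $ k))) = 0" for k
      proof -
        have "?f x $ k = 0"
          using x by simp
        then show ?thesis
          by (simp add: frame_map_nth sum.distrib sum_distrib_left algebra_simps)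
      qed
      then have "(\<Sum>j\<in>UNIV. (\<chi> j. complex_of_real (x $ j)) $ j *
          (\<chi> j k. complex_of_real (Re (v $ j $ k) + t * Im (v $ j $ k))) $ j $ k) = 0" for k
        by (simp flip: of_real_mult of_real_sum of_real_add)
      then have "(\<chi> j. complex_of_real (x $ j)) = 0"
        using det left_null_vector by blast
      then show "x = 0"
        by (simp add: vec_eq_iff)
    qed
  qed
  then show ?thesis ..
qed

text \<open>If \<open>\<Lambda>\<close> is transversal to a rotated copy of \<open>\<i>\<real>\<^sup>n\<close>, it is a rotated graph over \<open>\<real>\<^sup>n\<close> of a
  symmetric map; shrink the graph while undoing the rotation.\<close>

lemma lagrangian_path_to_real:
  fixes \<Lambda> :: "(complex ^ 'n) set"
  assumes lag: "lagrangian \<Lambda>"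
  shows "path_component_of lagrangian_grassmannian (range (\<lambda>x. \<chi> k. complex_of_real (x $ k))) \<Lambda>"
proof -
  obtain v where v: "is_basis v \<Lambda>"
    using lagrangian_has_basis[OF lag] .
  obtain t :: real where inj: "inj (\<lambda>x. \<chi> k. Re ((1 - \<i> * of_real t) * frame_map v x $ k))"
    using transversal_rotation[OF lagrangian_det_nonzero[OF v lag]] .
  define f where "f x = (\<chi> k. Re ((1 - \<i> * of_real t) * frame_map v x $ k))" for x
  define h where "h x = (\<chi> k. Im ((1 - \<i> * of_real t) * frame_map v x $ k))" for x
  have lin: "linear f" "linear h"
    by (rule linearI;
        simp add: f_def h_def vec_eq_iff linear_add linear_scale linear_frame_map algebra_simps)+
  have "inj f"
    using inj by (simp add: f_def[abs_def])
  then have "surj f"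
    using lin(1) linear_injective_imp_surjective by blast
  define f' where "f' = inv_into UNIV f"
  \<comment> \<open>Multiplied by 1 - it, \<Lambda> is the graph of \<sigma>: its vector with real
    part x has imaginary part \<sigma> x.\<close>
  define \<sigma> where "\<sigma> = h \<circ> f'"
  have linv: "linear f'"
    unfolding f'_def using lin(1) \<open>inj f\<close> by (rule inj_linear_imp_inv_linear)
  then have \<sigma>: "linear \<sigma>"
    unfolding \<sigma>_def using lin(2) by (rule linear_compose)
  \<comment> \<open>The factor runs from 1 at r = 0 to the chosen 1 - it at r = 1, and its real part
    1 keeps it invertible. Thus \<open>G\<close> joins the inclusion of R^n to a parametrization of
    \<Lambda>.\<close>
  define c where "c r = 1 - \<i> * complex_of_real (r * t)" for r :: real
  have c: "c r \<noteq> 0" for r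
    by (simp add: c_def complex_eq_iff)
  define G where "G r x = (\<chi> k. inverse (c r) * Complex (x $ k) (r * \<sigma> x $ k))" for r x
  define F where "F r = (\<chi> j. G r (axis j 1))" for r
  have linG: "linear (G r)" for r
    by (rule linearI)
      (simp_all add: G_def vec_eq_iff linear_add[OF \<sigma>] linear_scale[OF \<sigma>] Complex_eq
        algebra_simps flip: scaleR_conv_of_real)
  have FG: "frame_map (F r) = G r" for r
  proof (rule linear_eq_stdbasis[OF linear_frame_map linG])
    fix b :: "real ^ 'n" assume "b \<in> Basis"
    then show "frame_map (F r) b = G r b"
      by (auto simp: Basis_vec_def F_def)
  qed
  have injG: "inj (G r)" for r
  proof (rule injI)
    fix x y assume "G r x = G r y"
    then have "\<forall>k. Complex (x $ k) (r * \<sigma> x $ k) = Complex (y $ k) (r * \<sigma> y $ k)"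
      using c[of r] by (simp add: G_def vec_eq_iff)
    then show "x = y"
      by (simp add: vec_eq_iff)
  qed
  have G1: "G 1 x = frame_map v (f' x)" for x
  proof -
    have "Complex (x $ k) (\<sigma> x $ k) = c 1 * frame_map v (f' x) $ k" for k
    proof -
      have "f (f' x) = x"
        using \<open>surj f\<close> by (simp add: f'_def surj_f_inv_f)
      then have "x $ k = Re (c 1 * frame_map v (f' x) $ k)"
        by (metis (no_types, lifting) c_def f_def mult_1 vec_lambda_beta)
      moreover have "\<sigma> x $ k = Im (c 1 * frame_map v (f' x) $ k)"
        by (simp add: \<sigma>_def h_def c_def)
      ultimately show ?thesis
        by (simp add: complex_eq_iff)
    qed
    then show ?thesis
      using c[of 1] by (simp add: G_def vec_eq_iff)
  qed
  have range1: "range (G 1) = \<Lambda>"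
  proof -
    have "surj f'"
      unfolding f'_def using \<open>inj f\<close> by (rule inj_imp_surj_inv)
    then have "range (G 1) = range (frame_map v)"
      unfolding G1 by (metis (no_types) image_image)
    then show ?thesis
      using v by (simp add: is_basis_iff)
  qed
  have symp: "symp_form (G r x) (G r y) = (cmod (inverse (c r)))\<^sup>2 * r * (x \<bullet> \<sigma> y - \<sigma> x \<bullet> y)" for r x y
  proof -
    have "G r z = inverse (c r) *s (\<chi> k. Complex (z $ k) (r * \<sigma> z $ k))" for z
      by (simp add: G_def vec_eq_iff)
    then have "symp_form (G r x) (G r y) = (cmod (inverse (c r)))\<^sup>2 *
        symp_form (\<chi> k. Complex (x $ k) (r * \<sigma> x $ k)) (\<chi> k. Complex (y $ k) (r * \<sigma> y $ k))"
      by (simp only: symp_form_scale_complex)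
    also have "symp_form (\<chi> k. Complex (x $ k) (r * \<sigma> x $ k)) (\<chi> k. Complex (y $ k) (r * \<sigma> y $ k)) =
        r * (x \<bullet> \<sigma> y - \<sigma> x \<bullet> y)"
      by (simp add: symp_form_def inner_vec_def sum_distrib_left sum_subtractf algebra_simps)
    finally show ?thesis
      by simp
  qed
  \<comment> \<open>Isotropy at the endpoint r = 1 makes \<sigma> symmetric, and symmetry makes
    every intermediate graph isotropic.\<close>
  have sym: "x \<bullet> \<sigma> y = \<sigma> x \<bullet> y" for x y
  proof -
    have "symp_form (G 1 x) (G 1 y) = 0"
      using lag range1 by (auto simp: lagrangian_def)
    then show ?thesis
      using c[of 1] by (simp add: symp)
  qed
  have lagG: "lagrangian (range (G r))" for r
    using lagrangian_range_iff[of "F r"] injG symp sym by (simp add: FG)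
  have frames: "F r \<in> lagrangian_frames" for r
    using lagG injG by (auto simp: lagrangian_frames_def is_basis_iff FG)
  have "continuous_on {0..1} F"
    unfolding F_def G_def Complex_eq c_def
    by (intro continuous_intros) (use c in \<open>auto simp: c_def\<close>)
  then have "continuous_map (top_of_set {0..1}) (top_of_set lagrangian_frames) F"
    using frames by (simp add: continuous_map_in_subtopology image_subset_iff)
  then have "pathin lagrangian_grassmannian ((\<lambda>v. span (range (($) v))) \<circ> F)"
    unfolding pathin_def using continuous_map_span_frame by (rule continuous_map_compose)
  moreover have "((\<lambda>v. span (range (($) v))) \<circ> F) r = range (G r)" for r
    by (simp add: span_frame FG)
  moreover have "G 0 = (\<lambda>x. \<chi> k. complex_of_real (x $ k))"
    by (simp add: G_def c_def fun_eq_iff vec_eq_iff complex_eq_iff)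
  ultimately show ?thesis
    unfolding path_component_of_def using range1
    by (intro exI[of _ "(\<lambda>v. span (range (($) v))) \<circ> F"]) simp
qed

lemma lagrangian_bundle_nonempty: "\<exists>x. x \<in> topspace (lagrangian_bundle :: ((complex ^ 'n) \<times> _) topology)"
  using lagrangian_real by (auto simp: topspace_lagrangian_bundle)

lemma connected_lagrangian_bundle: "connected_space (lagrangian_bundle :: ((complex ^ 'n) \<times> _) topology)"
proof -
  have "path_connected_space (lagrangian_grassmannian :: (complex ^ 'n) set topology)"
    unfolding path_connected_space_iff_path_component topspace_lagrangian_grassmannian
  proof (intro ballI)
    fix \<Lambda> \<Lambda>' :: "(complex ^ 'n) set" assume "\<Lambda> \<in> {\<Lambda>. lagrangian \<Lambda>}" "\<Lambda>' \<in> {\<Lambda>. lagrangian \<Lambda>}"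
    then show "path_component_of lagrangian_grassmannian \<Lambda> \<Lambda>'"
      using path_component_of_trans[OF path_component_of_sym[OF lagrangian_path_to_real]
          lagrangian_path_to_real, of \<Lambda> \<Lambda>'] by simp
  qed
  then have "connected_space (lagrangian_grassmannian :: (complex ^ 'n) set topology)"
    by (rule path_connected_imp_connected_space)
  moreover have "connected_space (euclidean :: (complex ^ 'n) topology)"
    by (metis connected_UNIV connectedin_iff_connected connectedin_topspace topspace_euclidean)
  ultimately show ?thesis
    by (simp add: lagrangian_bundle_def connected_space_prod_topology)
qed

text \<open>Any two values of \<open>g\<close> differ by an integer, while connectedness makes the
  set of values an interval.\<close>

lemma grading_constant:
  fixes g :: "(complex ^ 'n) \<times> (complex ^ 'n) set \<Rightarrow> real"
  assumes g: "continuous_map lagrangian_bundle euclideanreal g"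
    and exp: "\<And>x. x \<in> topspace lagrangian_bundle \<Longrightarrow> exp (2 * of_real pi * \<i> * of_real (g x)) = c"
    and x: "x \<in> topspace lagrangian_bundle" and y: "y \<in> topspace lagrangian_bundle"
  shows "g x = g y"
proof (rule ccontr)
  assume "g x \<noteq> g y"
  have "connectedin euclideanreal (g ` topspace lagrangian_bundle)"
    using connectedin_continuous_map_image[OF g, of "topspace lagrangian_bundle"] connected_lagrangian_bundle
    by (simp only: connectedin_topspace)
  then have conn: "is_interval (g ` topspace lagrangian_bundle)"
    by (simp add: is_interval_connected_1)
  define a b where "a = min (g x) (g y)" and "b = max (g x) (g y)"
  have ab: "a < b" "a \<in> g ` topspace lagrangian_bundle" "b \<in> g ` topspace lagrangian_bundle"
    using \<open>g x \<noteq> g y\<close> x y by (auto simp: a_def b_def min_def max_def)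
  \<comment> \<open>A value in the interval strictly between a and a + 1, hence not at integer
    distance from a.\<close>
  define s where "s = min ((a + b) / 2) (a + 1 / 2)"
  have s: "a < s" "s \<le> b" "s < a + 1"
    using ab(1) by (auto simp: s_def min_def)
  then have "s \<in> g ` topspace lagrangian_bundle"
    using mem_is_interval_1_I[OF conn ab(2,3), of s] by simp
  then have "exp (2 * of_real pi * \<i> * of_real s) = exp (2 * of_real pi * \<i> * of_real a)"
    using ab(2) exp by fastforce
  then obtain k :: int where "2 * of_real pi * \<i> * of_real s = 2 * of_real pi * \<i> * complex_of_real a + of_real (of_int (2 * k) * pi) * \<i>"
    unfolding exp_eq by blast
  then have "2 * pi * s = 2 * pi * a + of_int (2 * k) * pi"
    by (simp add: complex_eq_iff)
  then have "(2 * pi) * s = (2 * pi) * (a + of_int k)"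
    by (simp add: ring_distribs)
  then have "s = a + of_int k"
    by (subst (asm) mult_cancel_left) simp
  then show False
    using s by simp
qed

section \<open>Diagonal symplectomorphisms\<close>

text \<open>The coinduction needs a class closed under directional derivatives. The derivative of a
  linear map is constant, so the class consists of affine maps.\<close>

lemma smooth_affine:
  fixes f :: "'a::euclidean_space \<Rightarrow> 'b::euclidean_space"
  assumes "linear f"
  shows "smooth (\<lambda>x. f x + c)"
proof (rule smooth.coinduct[where X = "\<lambda>h. \<exists>(g :: 'a \<Rightarrow> 'b) d. linear g \<and> h = (\<lambda>x. g x + d)"])
  fix h :: "'a \<Rightarrow> 'b" assume "\<exists>(g :: 'a \<Rightarrow> 'b) d. linear g \<and> h = (\<lambda>x. g x + d)"
  then obtain g :: "'a \<Rightarrow> 'b" and d where g: "linear g" and h: "h = (\<lambda>x. g x + d)"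
    by blast
  have der: "(h has_derivative g) (at x)" for x
    unfolding h using has_derivative_add[OF linear_imp_has_derivative[OF g] has_derivative_const] by simp
  then have "frechet_derivative h (at x) = g" for x
    by (rule frechet_derivative_at[symmetric])
  then have "linear (\<lambda>x::'a. 0 :: 'b)"
      "(\<lambda>x. frechet_derivative h (at x) v) = (\<lambda>x. 0 + g v)" for v
    by (auto simp: linear_zero)
  then show "\<exists>f. h = f \<and> (\<forall>x. f differentiable at x) \<and>
      (\<forall>v. (\<exists>(g :: 'a \<Rightarrow> 'b) d. linear g \<and> (\<lambda>x. frechet_derivative f (at x) v) = (\<lambda>x. g x + d)) \<or>
        smooth (\<lambda>x. frechet_derivative f (at x) v))"
    using der by (metis differentiable_def)
qed (use assms in blast)

lemma linear_diag_action: "linear (diag_action idx l)"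
  by (rule linearI) (simp_all add: diag_action_def vec_eq_iff algebra_simps)

lemma smooth_diag_action: "smooth (diag_action idx l)"
  using smooth_affine[OF linear_diag_action, of idx l 0] by simp

lemma frechet_derivative_diag_action: "frechet_derivative (diag_action idx l) (at p) = diag_action idx l"
  by (rule frechet_derivative_at[symmetric]) (rule linear_imp_has_derivative[OF linear_diag_action])

lemma tangent_action_diag_action:
  "tangent_action (diag_action idx l) (p, \<Lambda>) = (diag_action idx l p, diag_action idx l ` \<Lambda>)"
  by (simp add: tangent_action_def frechet_derivative_diag_action)

context
  fixes idx :: "'n::finite \<Rightarrow> nat" and l :: "nat \<Rightarrow> complex"
  assumes norm: "\<And>j. cmod (l (idx j)) = 1"
begin

lemma diag_action_inverse:
  "diag_action idx l (diag_action idx (\<lambda>i. inverse (l i)) z) = z"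
  "diag_action idx (\<lambda>i. inverse (l i)) (diag_action idx l z) = z"
proof -
  have "l (idx j) \<noteq> 0" for j
    using norm[of j] by auto
  then show "diag_action idx l (diag_action idx (\<lambda>i. inverse (l i)) z) = z"
    "diag_action idx (\<lambda>i. inverse (l i)) (diag_action idx l z) = z"
    by (simp_all add: diag_action_def vec_eq_iff)
qed

lemma symp_form_diag_action: "symp_form (diag_action idx l v) (diag_action idx l w) = symp_form v w"
proof -
  have "cnj (l (idx j) * x) * (l (idx j) * y) = cnj x * y" for j x y
  proof -
    have "l (idx j) * cnj (l (idx j)) = 1"
      using complex_norm_square[of "l (idx j)"] norm by simp
    then have "(l (idx j) * cnj (l (idx j))) * (cnj x * y) = cnj x * y"
      by simp
    then show ?thesis
      by (simp add: mult_ac)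
  qed
  then show ?thesis
    unfolding symp_form_def diag_action_def vec_lambda_beta by (simp only:)
qed

lemma symplectomorphism_diag_action: "symplectomorphism (diag_action idx l)"
proof -
  have "inv_into UNIV (diag_action idx l) = diag_action idx (\<lambda>i. inverse (l i))"
    by (rule inv_unique_comp) (auto simp: diag_action_inverse)
  moreover have "bij (diag_action idx l)"
    by (rule o_bij[of "diag_action idx (\<lambda>i. inverse (l i))"]) (auto simp: diag_action_inverse)
  ultimately show ?thesis
    by (simp add: symplectomorphism_def smooth_diag_action frechet_derivative_diag_action
        symp_form_diag_action)
qed

lemma diag_action_basis:
  assumes "is_basis v \<Lambda>"
  shows "is_basis (\<chi> i. diag_action idx l (v $ i)) (diag_action idx l ` \<Lambda>)"
proof -
  have "frame_map (\<chi> i. diag_action idx l (v $ i)) = diag_action idx l \<circ> frame_map v"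
    by (simp add: fun_eq_iff vec_eq_iff frame_map_nth diag_action_def sum_distrib_left mult_ac)
  moreover have "inj (diag_action idx l)"
    using symplectomorphism_diag_action by (simp add: symplectomorphism_def bij_def)
  ultimately show ?thesis
    using assms by (auto simp: is_basis_iff image_comp intro: inj_compose)
qed

lemma lagrangian_diag_action:
  assumes "lagrangian \<Lambda>"
  shows "lagrangian (diag_action idx l ` \<Lambda>)"
proof -
  have "dim (diag_action idx l ` \<Lambda>) = dim \<Lambda>"
    using symplectomorphism_diag_action
    by (intro dim_image_eq linear_diag_action) (auto simp: symplectomorphism_def bij_def intro: inj_on_subset)
  then show ?thesis
    using assms by (auto simp: lagrangian_def symp_form_diag_action linear_subspace_image[OF linear_diag_action])
qed

lemma tangent_action_diag_action_topspace:
  assumes "x \<in> topspace lagrangian_bundle"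
  shows "tangent_action (diag_action idx l) x \<in> topspace lagrangian_bundle"
  using assms lagrangian_diag_action
  by (cases x) (simp add: topspace_lagrangian_bundle tangent_action_diag_action)

text \<open>The action scales columns, so each Leibniz term contains every \<open>l (idx j)\<close>
  exactly once, in permuted order.\<close>

lemma det_diag_action:
  "det (\<chi> i. diag_action idx l (v $ i)) = (\<Prod>j\<in>UNIV. l (idx j)) * det v"
proof -
  have "(\<Prod>i\<in>UNIV. diag_action idx l (v $ i) $ p i) = (\<Prod>j\<in>UNIV. l (idx j)) * (\<Prod>i\<in>UNIV. v $ i $ p i)"
    if "p permutes UNIV" for p
  proof -
    have "(\<Prod>i\<in>UNIV. diag_action idx l (v $ i) $ p i) = (\<Prod>i\<in>UNIV. l (idx (p i))) * (\<Prod>i\<in>UNIV. v $ i $ p i)"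
      by (simp add: diag_action_def prod.distrib)
    also have "(\<Prod>i\<in>UNIV. l (idx (p i))) = (\<Prod>j\<in>UNIV. l (idx j))"
      using prod.permute[OF that, of "\<lambda>j. l (idx j)"] by (simp add: comp_def)
    finally show ?thesis .
  qed
  then show ?thesis
    by (simp add: det_def sum_distrib_left mult_ac)
qed

lemma lag_phase_diag_action:
  assumes "lagrangian \<Lambda>"
  shows "lag_phase (diag_action idx l ` \<Lambda>) = (\<Prod>j\<in>UNIV. l (idx j))\<^sup>2 * lag_phase \<Lambda>"
proof -
  obtain v where v: "is_basis v \<Lambda>"
    using lagrangian_has_basis[OF assms] .
  have "cmod (\<Prod>j\<in>UNIV. l (idx j)) = 1"
    by (simp add: norm flip: prod_norm)
  then show ?thesis
    using lag_phase_eq[OF v assms] lag_phase_eq[OF diag_action_basis[OF v] lagrangian_diag_action[OF assms]]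
    by (simp add: det_diag_action norm_mult power_mult_distrib)
qed

text \<open>The phase ratio is the same at every point of the bundle, so
  \<open>grading_constant\<close> reduces a lift to one logarithm of that number.\<close>

lemma graded_lift_diag_action:
  "(diag_action idx l, g) \<in> carrier graded_symplectomorphisms \<longleftrightarrow>
     (\<exists>s. g = (\<lambda>x\<in>topspace lagrangian_bundle. s) \<and>
        exp (2 * of_real pi * \<i> * of_real s) = (\<Prod>j\<in>UNIV. l (idx j))\<^sup>2)"
proof -
  let ?c = "(\<Prod>j\<in>UNIV. l (idx j))\<^sup>2" and ?B = "topspace lagrangian_bundle :: ((complex ^ 'n) \<times> _) set"
  have phase: "lag_phase (snd (tangent_action (diag_action idx l) x)) / lag_phase (snd x) = ?c"
    if "x \<in> ?B" for x
    using that lag_phase_diag_action[of "snd x"] lag_phase_nonzero[of "snd x"]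
    by (cases x) (simp add: topspace_lagrangian_bundle tangent_action_diag_action)
  obtain x0 where x0: "x0 \<in> ?B"
    using lagrangian_bundle_nonempty by blast
  show ?thesis
  proof
    assume "(diag_action idx l, g) \<in> carrier graded_symplectomorphisms"
    then have g: "g \<in> extensional ?B" "continuous_map lagrangian_bundle euclideanreal g"
      "\<And>x. x \<in> ?B \<Longrightarrow> exp (2 * of_real pi * \<i> * of_real (g x)) = ?c"
      by (auto simp: graded_symplectomorphisms_def phase)
    have "g = (\<lambda>x\<in>?B. g x0)"
      using g(1) grading_constant[OF g(2,3) _ x0] by (intro extensionalityI[of g ?B]) auto
    then show "\<exists>s. g = (\<lambda>x\<in>?B. s) \<and> exp (2 * of_real pi * \<i> * of_real s) = ?c"
      using g(3)[OF x0] by blast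
  next
    assume "\<exists>s. g = (\<lambda>x\<in>?B. s) \<and> exp (2 * of_real pi * \<i> * of_real s) = ?c"
    then obtain s where s: "g = (\<lambda>x\<in>?B. s)" "exp (2 * of_real pi * \<i> * of_real s) = ?c"
      by blast
    have "continuous_map lagrangian_bundle euclideanreal g"
      by (rule continuous_map_eq[of _ _ "\<lambda>_. s"]) (auto simp: s)
    then show "(diag_action idx l, g) \<in> carrier graded_symplectomorphisms"
      using s symplectomorphism_diag_action by (simp add: graded_symplectomorphisms_def phase)
  qed
qed

end

section \<open>Graded lifts of diagonal symplectomorphisms\<close>

text \<open>The number 2S: the squared determinant of \<phi>_a is this power of exp(2 pi i /
  d).\<close>

definition phase_weight :: "nat list \<Rightarrow> int" where
  "phase_weight a = 2 * (\<Sum>i<length a. weight a i)"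

text \<open>The lift of the m-th power of \<phi>_a with grading 2Sm/d, shifted by [k];
  \<open>- of_int k\<close> follows the sign convention of \<open>graded_shift\<close>.\<close>

definition graded_lift :: "nat list \<Rightarrow> ('n::finite \<Rightarrow> nat) \<Rightarrow> int \<times> int \<Rightarrow> 'n graded_map" where
  "graded_lift a idx = (\<lambda>(m, k). (diag_action idx (Gamma0_power a m),
     \<lambda>x\<in>topspace lagrangian_bundle. of_int (phase_weight a * m) / of_nat (prod_list a) - of_int k))"

context
  fixes a :: "nat list" and idx :: "'n::finite \<Rightarrow> nat"
  assumes len: "length a = CARD('n)" and pos: "prod_list a > 0"
    and idx: "bij_betw idx UNIV {..<CARD('n)}"
begin

lemma a_nonempty: "a \<noteq> []"
  using len by auto

lemma idx_less: "idx j < length a"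
  using idx len by (auto simp: bij_betw_def)

text \<open>Faithfulness makes the \<open>inv_into\<close> in \<open>Gamma0_hat_proj\<close> a
  genuine inverse. The vector of ones reads off the coordinates.\<close>

lemma inj_on_diag_action: "inj_on (diag_action idx) (carrier (Gamma0 a))"
proof (rule inj_onI)
  fix l l' assume l: "l \<in> carrier (Gamma0 a)" "l' \<in> carrier (Gamma0 a)"
    and eq: "diag_action idx l = diag_action idx l'"
  show "l = l'"
  proof (rule extensionalityI)
    show "l \<in> extensional {..<length a}" "l' \<in> extensional {..<length a}"
      using l by (auto simp: carrier_Gamma0)
    fix i assume "i \<in> {..<length a}"
    then obtain j where "i = idx j"
      using idx len by (auto simp: bij_betw_def)
    moreover have "diag_action idx l (\<chi> j. 1) $ j = diag_action idx l' (\<chi> j. 1) $ j"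
      using eq by simp
    ultimately show "l i = l' i"
      by (simp add: diag_action_def)
  qed
qed

lemma norm_Gamma0_power: "cmod (Gamma0_power a m (idx j)) = 1"
  using idx_less by (simp add: Gamma0_power_def)

lemma diag_action_compose:
  "diag_action idx (Gamma0_power a m) \<circ> diag_action idx (Gamma0_power a m') =
     diag_action idx (Gamma0_power a (m + m'))"
  using idx_less
  by (simp add: fun_eq_iff vec_eq_iff diag_action_def Gamma0_power_def ring_distribs root_of_unity_add mult_ac)

lemma diag_action_Gamma0_power_0: "diag_action idx (Gamma0_power a 0) = id"
  using idx_less by (simp add: fun_eq_iff vec_eq_iff diag_action_def Gamma0_power_def)

lemma prod_Gamma0_power:
  "(\<Prod>j\<in>UNIV. Gamma0_power a m (idx j))\<^sup>2 = root_of_unity (int (prod_list a)) (phase_weight a * m)"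
proof -
  have "(\<Prod>j\<in>UNIV. Gamma0_power a m (idx j)) = (\<Prod>i<length a. Gamma0_power a m i)"
    using prod.reindex_bij_betw[OF idx, of "Gamma0_power a m"] len by simp
  also have "\<dots> = root_of_unity (int (prod_list a)) (\<Sum>i<length a. m * weight a i)"
    by (simp add: Gamma0_power_def root_of_unity_prod)
  finally show ?thesis
    by (simp add: root_of_unity_power phase_weight_def sum_distrib_left mult_ac)
qed

text \<open>For fixed m, the admissible constants are the logarithms of one complex number, divided
  by 2 pi i. They form the coset 2Sm/d + Z, which \<open>k\<close> enumerates.\<close>

lemma carrier_Gamma0_hat: "carrier (Gamma0_hat idx a) = range (graded_lift a idx)"
proof
  show "range (graded_lift a idx) \<subseteq> carrier (Gamma0_hat idx a)"
  proof
    fix x assume "x \<in> range (graded_lift a idx)"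
    then obtain m k where x: "x = graded_lift a idx (m, k)"
      by auto
    have "exp (2 * of_real pi * \<i> * of_real (of_int (phase_weight a * m) / of_nat (prod_list a) - of_int k)) =
        root_of_unity (int (prod_list a)) (phase_weight a * m)"
    proof -
      have "exp (2 * of_real pi * \<i> * of_real (of_int (phase_weight a * m) / of_nat (prod_list a) - of_int k)) =
          cis (2 * pi * of_int (phase_weight a * m) / of_int (int (prod_list a)) - 2 * pi * of_int k)"
        by (simp add: cis_conv_exp algebra_simps)
      also have "\<dots> = root_of_unity (int (prod_list a)) (phase_weight a * m)"
        by (simp add: root_of_unity_def flip: cis_divide)
      finally show ?thesis .
    qed
    then have "x \<in> carrier graded_symplectomorphisms"
      unfolding x graded_lift_def prod.case
      by (subst graded_lift_diag_action) (auto simp: norm_Gamma0_power prod_Gamma0_power)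
    then show "x \<in> carrier (Gamma0_hat idx a)"
      using Gamma0_power_in_carrier[OF a_nonempty pos]
      by (auto simp: Gamma0_hat_def x graded_lift_def)
  qed
  show "carrier (Gamma0_hat idx a) \<subseteq> range (graded_lift a idx)"
  proof
    fix x assume x: "x \<in> carrier (Gamma0_hat idx a)"
    then obtain l where l: "l \<in> carrier (Gamma0 a)" "fst x = diag_action idx l"
      by (auto simp: Gamma0_hat_def)
    then obtain m where m: "fst x = diag_action idx (Gamma0_power a m)"
      using Gamma0_power_surj[OF a_nonempty pos] by blast
    have "(diag_action idx (Gamma0_power a m), snd x) \<in> carrier graded_symplectomorphisms"
      using x by (simp add: Gamma0_hat_def flip: m)
    then obtain s where s: "snd x = (\<lambda>x\<in>topspace lagrangian_bundle. s)"
      and exp: "exp (2 * of_real pi * \<i> * of_real s) = root_of_unity (int (prod_list a)) (phase_weight a * m)"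
      by (subst (asm) graded_lift_diag_action) (auto simp: norm_Gamma0_power prod_Gamma0_power)
    have "cis (2 * pi * s) = cis (2 * pi * of_int (phase_weight a * m) / of_nat (prod_list a))"
      using exp by (simp add: root_of_unity_def cis_conv_exp mult_ac)
    then have "cis (2 * pi * (of_int (phase_weight a * m) / of_nat (prod_list a) - s)) = 1"
      by (simp add: right_diff_distrib flip: cis_divide)
    then obtain k :: int where "2 * pi * (of_int (phase_weight a * m) / of_nat (prod_list a) - s) = 2 * pi * of_int k"
      by (auto simp: cis_conv_exp exp_eq_1 mult_ac)
    then have "s = of_int (phase_weight a * m) / of_nat (prod_list a) - of_int k"
      by (subst (asm) mult_cancel_left) simp
    then have "x = graded_lift a idx (m, k)"
      using m s by (simp add: graded_lift_def prod_eq_iff)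
    then show "x \<in> range (graded_lift a idx)"
      by simp
  qed
qed

text \<open>Constant gradings simply add. The tangent action must stay inside the bundle, for
  outside it a grading has the default value of restricted functions.\<close>

lemma graded_lift_add:
  "graded_lift a idx (m, k) \<otimes>\<^bsub>Gamma0_hat idx a\<^esub> graded_lift a idx (m', k') = graded_lift a idx (m + m', k + k')"
proof -
  have "tangent_action (diag_action idx (Gamma0_power a m')) x \<in> topspace lagrangian_bundle"
    if "x \<in> topspace lagrangian_bundle" for x
    using that by (intro tangent_action_diag_action_topspace norm_Gamma0_power)
  then show ?thesis
    by (auto simp: Gamma0_hat_def graded_symplectomorphisms_def graded_lift_def diag_action_compose
        ring_distribs add_divide_distrib)
qed

lemma one_Gamma0_hat: "\<one>\<^bsub>Gamma0_hat idx a\<^esub> = graded_lift a idx (0, 0)"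
  by (simp add: Gamma0_hat_def graded_symplectomorphisms_def graded_lift_def diag_action_Gamma0_power_0)

lemma graded_shift_eq: "graded_shift k = graded_lift a idx (0, k)"
  by (simp add: graded_shift_def graded_lift_def diag_action_Gamma0_power_0)

lemma graded_lift_epi: "graded_lift a idx \<in> epi (integer_group \<times>\<times> integer_group) (Gamma0_hat idx a)"
  by (auto simp: epi_def hom_def carrier_Gamma0_hat graded_lift_add)

text \<open>The underlying map is the identity exactly when d divides m; for m = dr the grading
  becomes 2Sr - k.\<close>

lemma graded_lift_eq_one_iff:
  "graded_lift a idx (m, k) = \<one>\<^bsub>Gamma0_hat idx a\<^esub> \<longleftrightarrow>
     (\<exists>r. m = int (prod_list a) * r \<and> k = phase_weight a * r)"
proof -
  obtain x where x: "x \<in> topspace (lagrangian_bundle :: ((complex ^ 'n) \<times> _) topology)"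
    using lagrangian_bundle_nonempty by blast
  \<comment> \<open>A point of the bundle is needed to recover the constant from the restricted
    function.\<close>
  have const: "(\<lambda>x\<in>topspace (lagrangian_bundle :: ((complex ^ 'n) \<times> _) topology). s) =
      (\<lambda>x\<in>topspace lagrangian_bundle. 0) \<longleftrightarrow> s = 0" for s :: real
    using x by (metis restrict_apply')
  have "diag_action idx (Gamma0_power a m) = diag_action idx (Gamma0_power a 0) \<longleftrightarrow>
      Gamma0_power a m = Gamma0_power a 0"
    using Gamma0_power_in_carrier[OF a_nonempty pos] by (intro inj_on_eq_iff[OF inj_on_diag_action])
  then have "diag_action idx (Gamma0_power a m) = diag_action idx (Gamma0_power a 0) \<longleftrightarrow> int (prod_list a) dvd m"
    by (simp only: Gamma0_power_eq_one_iff[OF a_nonempty pos] Gamma0_power_0[OF a_nonempty pos])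
  then have "graded_lift a idx (m, k) = \<one>\<^bsub>Gamma0_hat idx a\<^esub> \<longleftrightarrow>
      int (prod_list a) dvd m \<and> of_int (phase_weight a * m) / of_nat (prod_list a) - of_int k = (0::real)"
    by (simp add: one_Gamma0_hat graded_lift_def const del: of_int_mult)
  also have "\<dots> \<longleftrightarrow> int (prod_list a) dvd m \<and> phase_weight a * m = k * int (prod_list a)"
  proof -
    have "of_int (phase_weight a * m) / of_nat (prod_list a) - of_int k = (0::real) \<longleftrightarrow>
        real_of_int (phase_weight a * m) = of_int (k * int (prod_list a))"
      using pos by (simp add: field_simps)
    then show ?thesis
      by (simp only: of_int_eq_iff)
  qed
  also have "\<dots> \<longleftrightarrow> (\<exists>r. m = int (prod_list a) * r \<and> k = phase_weight a * r)"
    using pos by auto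
  finally show ?thesis .
qed

lemma Gamma0_hat_presented:
  "presented_extension (int (prod_list a)) (phase_weight a) (Gamma0_hat idx a) (Gamma0 a)
     graded_shift (Gamma0_hat_proj idx a) (graded_lift a idx) (Gamma0_power a)"
proof -
  have "group (Gamma0_hat idx a)"
    using group_epi_image[OF DirProd_group[OF group_integer_group group_integer_group] graded_lift_epi]
    by (simp add: one_Gamma0_hat)
  moreover have "Gamma0_hat_proj idx a (graded_lift a idx (m, k)) = Gamma0_power a m" for m k
    using inj_on_diag_action Gamma0_power_in_carrier[OF a_nonempty pos]
    by (simp add: Gamma0_hat_proj_def graded_lift_def)
  ultimately show ?thesis
    unfolding presented_extension_def
    by (simp add: group_Gamma0[OF a_nonempty pos] Gamma0_power_epi[OF a_nonempty pos]
        graded_lift_epi graded_lift_eq_one_iff Gamma0_power_eq_one_iff[OF a_nonempty pos] graded_shift_eq)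
qed

end

theorem proposition1p2p1:
  fixes a :: "nat list" and idx :: "'n::finite \<Rightarrow> nat"
  assumes "length a = CARD('n)"
    and "\<forall>i < length a. a ! i \<ge> 2"
    and "bij_betw idx UNIV {..<CARD('n)}"
  shows "\<exists>\<theta> \<Psi>.
     \<theta> \<in> iso (Gamma0 a) (L0 (rev a)) \<and>
     \<theta> (Gamma0_gen a) = Ltilde_proj (rev a) (Ltilde_tau (rev a)) \<and>
     extension_iso integer_group
       (Gamma0_hat idx a) (Gamma0 a) graded_shift (Gamma0_hat_proj idx a)
       (Ltilde (rev a)) (L0 (rev a)) (T_power (rev a)) (Ltilde_proj (rev a)) \<theta> \<Psi> \<and>
     \<Psi> (graded_shift 1) = Ltilde_T (rev a) \<and>
     (\<exists>g. (diag_action idx (Gamma0_gen a), g) \<in> carrier (Gamma0_hat idx a) \<and>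
          \<Psi> (diag_action idx (Gamma0_gen a), g) = Ltilde_tau (rev a))"
proof -
  let ?b = "rev a"
  have a: "a \<noteq> []" "?b \<noteq> []"
    using assms(1) by auto
  have "0 \<notin> set a"
    using assms(2) by (auto simp: in_set_conv_nth)
  then have pos: "prod_list a > 0" "prod_list ?b > 0"
    using prod_list_zero_iff[of a] by auto
  note hat = Gamma0_hat_presented[OF assms(1) pos(1) assms(3)]
  \<comment> \<open>Here the two presentations meet: \<open>T_coeff_length\<close> at
    \<open>rev a\<close> yields weights of \<open>rev (rev a)\<close>, which is \<open>a\<close>, so
    the T-coefficient becomes \<open>phase_weight a\<close>.\<close>
  have "presented_extension (int (prod_list a)) (phase_weight a) (Ltilde ?b) (L0 ?b)
      (T_power ?b) (Ltilde_proj ?b) (tau_T_class ?b) (L0_power ?b)"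
    using Ltilde_presented[OF a(2) pos(2)] T_coeff_length[of ?b] by (simp add: phase_weight_def)
  note L = this
  obtain \<theta> \<Psi> where iso: "extension_iso integer_group
       (Gamma0_hat idx a) (Gamma0 a) graded_shift (Gamma0_hat_proj idx a)
       (Ltilde ?b) (L0 ?b) (T_power ?b) (Ltilde_proj ?b) \<theta> \<Psi>"
    and \<theta>: "\<And>m. \<theta> (Gamma0_power a m) = L0_power ?b m"
    and \<Psi>: "\<And>m k. \<Psi> (graded_lift a idx (m, k)) = tau_T_class ?b (m, k)"
    using presented_extension_iso[OF hat L] pos(1) by auto
  have tau: "Ltilde_tau ?b = tau_T_class ?b (1, 0)"
    by (rule Ltilde_tau_eq[OF a(2) pos(2)])
  have "\<theta> (Gamma0_gen a) = Ltilde_proj ?b (Ltilde_tau ?b)"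
    using L by (simp add: presented_extension_def tau \<theta> Gamma0_gen_eq[OF a(1) pos(1)])
  moreover have "\<Psi> (graded_shift 1) = Ltilde_T ?b"
    by (simp add: graded_shift_eq[OF assms(1) pos(1) assms(3)] \<Psi> Ltilde_T_def tau_T_class_def X0_T_comb_def)
  moreover have "\<exists>g. (diag_action idx (Gamma0_gen a), g) \<in> carrier (Gamma0_hat idx a) \<and>
      \<Psi> (diag_action idx (Gamma0_gen a), g) = Ltilde_tau ?b"
  proof (intro exI conjI)
    \<comment> \<open>The pair (1, 0) represents \<tau> on one side and the lift of \<phi>_a with
      constant grading 2S/d on the other.\<close>
    let ?g = "snd (graded_lift a idx (1, 0))"
    have "(diag_action idx (Gamma0_gen a), ?g) = graded_lift a idx (1, 0)"
      by (simp add: graded_lift_def Gamma0_gen_eq[OF a(1) pos(1)])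
    then show "(diag_action idx (Gamma0_gen a), ?g) \<in> carrier (Gamma0_hat idx a)"
      "\<Psi> (diag_action idx (Gamma0_gen a), ?g) = Ltilde_tau ?b"
      using carrier_Gamma0_hat[OF assms(1) pos(1) assms(3)] by (auto simp: \<Psi> tau)
  qed
  ultimately show ?thesis
    using iso unfolding extension_iso_def by blast
qed

end
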